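(* Let $\mu,\nu>0$ with $\mu+\nu=1$, let $N$ and $C_N$ be integers with $1\le C_N\le N$, and let $(X_N(t))_{t\ge0}$ be the Engset process with $N$ sources, capacity $C_N$ and parameters $\nu,\mu$. For $0\le x\le C_N$ let $T_x^{X_N}=\inf\{s\ge0:X_N(s)=x\}$, and define $$B_x(\alpha)=\int_0^1(1-u)^x\left(1+\frac{\nu}{\mu}u\right)^{N-x}u^{\alpha-1}\,du,\qquad D_x(\alpha)=\int_0^1(1-u)^{N-x}\left(1+\frac{\mu}{\nu}u\right)^{x}u^{\alpha-1}\,du,$$ $$b_N(\alpha)=\nu\int_0^1(1-u)^{C_N}\left(1+\frac{\nu}{\mu}u\right)^{N-C_N-1}u^\alpha\,du,\qquad d_N(\alpha)=\mu\int_0^1(1-u)^{N-C_N-1}\left(1+\frac{\mu}{\nu}u\right)^{C_N}u^\alpha\,du.$$ Then for $0\le x\le y\le C_N$ and $\alpha\ge0$, $$\mathbb{E}_x\left(e^{-\alpha T_y^{X_N}}\right)=\frac{D_x(\alpha)}{D_y(\alpha)}\quad\text{and}\quad \mathbb{E}_y\left(e^{-\alpha T_x^{X_N}}\right)=\frac{d_N(\alpha)B_y(\alpha)+b_N(\alpha)D_y(\alpha)}{d_N(\alpha)B_x(\alpha)+b_N(\alpha)D_x(\alpha)}.$$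
   Context: The Engset process $(X_N(t))_{t\ge0}$ with $N$ sources, capacity $C_N$ ($1\le C_N\le N$) and parameters $\nu,\mu>0$ is the continuous-time birth and death Markov process on $\{0,1,\ldots,C_N\}$ with transition rates $q(x,x-1)=\mu x$ for $0\le x\le C_N$ and $q(x,x+1)=\nu(N-x)$ for $0\le x<C_N$ (no upward jump from $C_N$). The time scale is normalized so that $\mu+\nu=1$. $\mathbb{E}_z$ denotes expectation when the process starts at $X_N(0)=z$.
   Formalization: At α=0 the integrals B_x, D_x diverge, and for C_N=N so does d_N, making the affected printed quotients ∞/∞; in those cases the formulas are read as the limit, as e→0+, of the same quotients with all integrals taken over [e,1−e]. All other cases are stated literally. *)

theory Defs
  imports "HOL-Probability.Probability"
begin

definition transition_function :: "'s set \<Rightarrow> (real \<Rightarrow> 's \<Rightarrow> 's \<Rightarrow> real) \<Rightarrow> bool" where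
  "transition_function S p \<longleftrightarrow>
     (\<forall>t\<ge>0. \<forall>x\<in>S. \<forall>y\<in>S. 0 \<le> p t x y) \<and>
     (\<forall>t\<ge>0. \<forall>x\<in>S. (\<Sum>y\<in>S. p t x y) = 1) \<and>
     (\<forall>x\<in>S. \<forall>y\<in>S. p 0 x y = of_bool (x = y)) \<and>
     (\<forall>s\<ge>0. \<forall>t\<ge>0. \<forall>x\<in>S. \<forall>y\<in>S. p (s + t) x y = (\<Sum>z\<in>S. p s x z * p t z y))"

(* Only the off-diagonal rates q x y (x \<noteq> y) enter. On a finite state space the row sums of p
   then force continuity at 0 and the diagonal entry - (sum of the off-diagonal rates). *)
definition has_transition_rates ::
    "'s set \<Rightarrow> ('s \<Rightarrow> 's \<Rightarrow> real) \<Rightarrow> (real \<Rightarrow> 's \<Rightarrow> 's \<Rightarrow> real) \<Rightarrow> bool" where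
  "has_transition_rates S q p \<longleftrightarrow>
     (\<forall>x\<in>S. \<forall>y\<in>S. x \<noteq> y \<longrightarrow> ((\<lambda>h. p h x y / h) \<longlongrightarrow> q x y) (at_right 0))"

(* The time-homogeneous Markov property
     P(X(t_{n+1}) = s_{n+1} | X(t_0) = s_0, ..., X(t_n) = s_n) = p (t_{n+1} - t_n) s_n s_{n+1},
   multiplied out so that conditioning events of probability 0 need no exception. *)
definition markov_property ::
    "'w measure \<Rightarrow> 's set \<Rightarrow> (real \<Rightarrow> 's \<Rightarrow> 's \<Rightarrow> real) \<Rightarrow> (real \<Rightarrow> 'w \<Rightarrow> 's) \<Rightarrow> bool" where
  "markov_property M S p X \<longleftrightarrow>
     (\<forall>n (t :: nat \<Rightarrow> real) s. 0 \<le> t 0 \<longrightarrow> mono t \<longrightarrow> range s \<subseteq> S \<longrightarrow>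
        \<P>(w in M. \<forall>i\<le>Suc n. X (t i) w = s i) =
        \<P>(w in M. \<forall>i\<le>n. X (t i) w = s i) * p (t (Suc n) - t n) (s n) (s (Suc n)))"

(* Continuous-time Markov process on the finite set S with rates q, started at z. The topology of
   nat is discrete, so right-continuity says that a path is constant on some [t, t + e), e > 0. *)
definition ctmc ::
    "'w measure \<Rightarrow> nat set \<Rightarrow> (nat \<Rightarrow> nat \<Rightarrow> real) \<Rightarrow> nat \<Rightarrow> (real \<Rightarrow> 'w \<Rightarrow> nat) \<Rightarrow> bool" where
  "ctmc M S q z X \<longleftrightarrow>
     prob_space M \<and>
     (\<forall>t\<ge>0. X t \<in> M \<rightarrow>\<^sub>M count_space UNIV) \<and>
     (\<forall>w\<in>space M. \<forall>t\<ge>0. X t w \<in> S) \<and>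
     (\<forall>w\<in>space M. \<forall>t\<ge>0. continuous (at_right t) (\<lambda>s. X s w)) \<and>
     (AE w in M. X 0 w = z) \<and>
     (\<exists>p. transition_function S p \<and> has_transition_rates S q p \<and> markov_property M S p X)"

definition engset_rate :: "nat \<Rightarrow> nat \<Rightarrow> real \<Rightarrow> real \<Rightarrow> nat \<Rightarrow> nat \<Rightarrow> real" where
  "engset_rate N C \<nu> \<mu> x y =
     (if x = Suc y then \<mu> * real x
      else if y = Suc x \<and> x < C then \<nu> * (real N - real x)
      else 0)"

definition engset_process ::
    "'w measure \<Rightarrow> nat \<Rightarrow> nat \<Rightarrow> real \<Rightarrow> real \<Rightarrow> nat \<Rightarrow> (real \<Rightarrow> 'w \<Rightarrow> nat) \<Rightarrow> bool" where
  "engset_process M N C \<nu> \<mu> z X \<longleftrightarrow> ctmc M {0..C} (engset_rate N C \<nu> \<mu>) z X"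

(* The infimum is taken in ereal, so it is \<infinity> if x is never reached. *)
definition hitting_time :: "(real \<Rightarrow> 'w \<Rightarrow> 's) \<Rightarrow> 's \<Rightarrow> 'w \<Rightarrow> ereal" where
  "hitting_time X x w = (INF s\<in>{s. 0 \<le> s \<and> X s w = x}. ereal s)"

(* exp (- \<alpha> T), read as 0 at T = \<infinity> also for \<alpha> = 0. *)
definition exp_neg :: "real \<Rightarrow> ereal \<Rightarrow> real" where
  "exp_neg \<alpha> T = (if T = \<infinity> then 0 else exp (- \<alpha> * real_of_ereal T))"

definition hitting_laplace :: "'w measure \<Rightarrow> (real \<Rightarrow> 'w \<Rightarrow> nat) \<Rightarrow> nat \<Rightarrow> real \<Rightarrow> real" where
  "hitting_laplace M X x \<alpha> = (LINT w|M. exp_neg \<alpha> (hitting_time X x w))"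

(* The domain of integration A is {0..1}, or {e..1-e} to give a meaning to quotients of divergent
   integrals: B and D diverge at u = 0 when \<alpha> = 0, and d diverges at u = 1 when C = N. The library
   assigns the value 0 to a divergent integral. *)
definition engset_B :: "real set \<Rightarrow> nat \<Rightarrow> real \<Rightarrow> real \<Rightarrow> nat \<Rightarrow> real \<Rightarrow> real" where
  "engset_B A N \<nu> \<mu> x \<alpha> =
     (LBINT u:A. (1 - u) ^ x * (1 + \<nu> / \<mu> * u) ^ (N - x) * u powr (\<alpha> - 1))"

definition engset_D :: "real set \<Rightarrow> nat \<Rightarrow> real \<Rightarrow> real \<Rightarrow> nat \<Rightarrow> real \<Rightarrow> real" where
  "engset_D A N \<nu> \<mu> x \<alpha> =
     (LBINT u:A. (1 - u) ^ (N - x) * (1 + \<mu> / \<nu> * u) ^ x * u powr (\<alpha> - 1))"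

(* The exponent N - C - 1 equals -1 when C = N, hence the integer power. *)
definition engset_b :: "real set \<Rightarrow> nat \<Rightarrow> nat \<Rightarrow> real \<Rightarrow> real \<Rightarrow> real \<Rightarrow> real" where
  "engset_b A N C \<nu> \<mu> \<alpha> =
     \<nu> * (LBINT u:A. (1 - u) ^ C * (1 + \<nu> / \<mu> * u) powi (int N - int C - 1) * u powr \<alpha>)"

definition engset_d :: "real set \<Rightarrow> nat \<Rightarrow> nat \<Rightarrow> real \<Rightarrow> real \<Rightarrow> real \<Rightarrow> real" where
  "engset_d A N C \<nu> \<mu> \<alpha> =
     \<mu> * (LBINT u:A. (1 - u) powi (int N - int C - 1) * (1 + \<mu> / \<nu> * u) ^ C * u powr \<alpha>)"

definition up_quotient ::
    "real set \<Rightarrow> nat \<Rightarrow> real \<Rightarrow> real \<Rightarrow> nat \<Rightarrow> nat \<Rightarrow> real \<Rightarrow> real" where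
  "up_quotient A N \<nu> \<mu> x y \<alpha> = engset_D A N \<nu> \<mu> x \<alpha> / engset_D A N \<nu> \<mu> y \<alpha>"

definition down_quotient ::
    "real set \<Rightarrow> nat \<Rightarrow> nat \<Rightarrow> real \<Rightarrow> real \<Rightarrow> nat \<Rightarrow> nat \<Rightarrow> real \<Rightarrow> real" where
  "down_quotient A N C \<nu> \<mu> x y \<alpha> =
     (engset_d A N C \<nu> \<mu> \<alpha> * engset_B A N \<nu> \<mu> y \<alpha> + engset_b A N C \<nu> \<mu> \<alpha> * engset_D A N \<nu> \<mu> y \<alpha>) /
     (engset_d A N C \<nu> \<mu> \<alpha> * engset_B A N \<nu> \<mu> x \<alpha> + engset_b A N C \<nu> \<mu> \<alpha> * engset_D A N \<nu> \<mu> x \<alpha>)"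

end

(*
  Sampling the process at the times i / (n + 1) gives a discrete Markov chain. If f equals 1 at the
  target and Q f = \<alpha> f elsewhere, where Q is the generator, then the discounted sum of the
  first-hit masses of this chain telescopes to f(z) up to an error that vanishes as n tends to
  infinity; by right-continuity of the paths it also converges to E_z exp(-\<alpha> T). Hence the Laplace
  transform is the harmonic function f.

  Integration by parts shows that D is harmonic below any state, B is harmonic above state 0, and
  d B + b D satisfies in addition the reflecting equation at C, because d and b are the increments
  of D and of -B at C up to the factor \<mu> \<nu>. For C = N the upward rate at C vanishes and B alone
  serves; this is the limiting case d = \<infinity>.

  At \<alpha> = 0, both sides are limits equal to 1: D and B differ from the integral of u^(\<alpha>-1) by
  a bounded amount, uniformly in \<alpha> and in the domain of integration, and this integral diverges.
*)
theory Submission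
  imports Defs "HOL-Real_Asymp.Real_Asymp"
begin

section \<open>First passage of a finite Markov process\<close>

text \<open>The Markov property concerns finitely many fixed times, and a hitting time is not of
  that kind. On a grid, however, a first visit at step k is a finite union of path events, so its
  probability is governed by the transition function. With mesh h, the one-step defect of f is o(h)
  while the discount loses about \<alpha> h per step, so the accumulated error is o(h) / (\<alpha>
  h). This is where \<alpha> > 0 matters, and why \<alpha> = 0 is reached by letting \<alpha> tend
  to 0. The grid has (n + 1)^2 steps of length 1 / (n + 1), so that the time horizon n + 1 tends to
  infinity as well.

  On the analytic side, exchanging \<mu> with \<nu> and x with N - x turns B into D; for C < N,
  exchanging C with N - C - 1 turns b into d. Thus only D and d are computed. The normalization
  enters through \<nu> (1 + \<mu> / \<nu>) = 1.\<close>

lemma (in prob_space) prob_path_sum: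
  fixes Y :: "nat \<Rightarrow> 'a \<Rightarrow> nat"
  assumes R: "finite R" "R \<subseteq> extensional {..n}"
    and meas: "\<And>i. Y i \<in> M \<rightarrow>\<^sub>M count_space UNIV"
    and V: "Measurable.pred M V"
  shows "prob {w \<in> space M. restrict (\<lambda>i. Y i w) {..n} \<in> R \<and> V w} =
    (\<Sum>\<sigma>\<in>R. prob {w \<in> space M. (\<forall>i\<le>n. Y i w = \<sigma> i) \<and> V w})"
proof -
  note [measurable] = meas V
  \<comment> \<open>Elements of \<open>R\<close> are \<open>undefined\<close> beyond
    \<open>n\<close>, so a path segment is a single function and the events for different \<sigma>
    are disjoint.\<close>
  have eq: "restrict (\<lambda>i. Y i w) {..n} = \<sigma> \<longleftrightarrow> (\<forall>i\<le>n. Y i w = \<sigma> i)" if "\<sigma> \<in> R" for w \<sigma>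
    using that R(2) by (auto simp: fun_eq_iff extensional_def restrict_def split: if_splits)
  have "{w \<in> space M. restrict (\<lambda>i. Y i w) {..n} \<in> R \<and> V w} =
     (\<Union>\<sigma>\<in>R. {w \<in> space M. (\<forall>i\<le>n. Y i w = \<sigma> i) \<and> V w})"
    by (auto simp: eq[symmetric])
  moreover have "disjoint_family_on (\<lambda>\<sigma>. {w \<in> space M. (\<forall>i\<le>n. Y i w = \<sigma> i) \<and> V w}) R"
    unfolding disjoint_family_on_def by (auto simp: eq[symmetric])
  moreover have "(\<lambda>\<sigma>. {w \<in> space M. (\<forall>i\<le>n. Y i w = \<sigma> i) \<and> V w}) ` R \<subseteq> events"
    by auto
  ultimately show ?thesis
    using finite_measure_finite_Union[OF R(1)] by simp
qed

text \<open>The Markov property is given for one prescribed path at a time. Summing it over all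
  paths inside \<open>A\<close>, grouped by the state at time \<open>n\<close>, yields the one-step
  recursion of the chain killed on leaving \<open>A\<close>.\<close>

lemma (in prob_space) prob_taboo_step:
  fixes Y :: "nat \<Rightarrow> 'a \<Rightarrow> nat"
  assumes fin: "finite S" and A: "A \<subseteq> S" and s': "s' \<in> S"
    and meas: "\<And>i. Y i \<in> M \<rightarrow>\<^sub>M count_space UNIV"
    and markov: "\<And>n s. range s \<subseteq> S \<Longrightarrow>
      prob {w \<in> space M. \<forall>i\<le>Suc n. Y i w = s i} =
      prob {w \<in> space M. \<forall>i\<le>n. Y i w = s i} * P (s n) (s (Suc n))"
  shows "prob {w \<in> space M. (\<forall>i\<le>n. Y i w \<in> A) \<and> Y (Suc n) w = s'} =
    (\<Sum>s\<in>A. prob {w \<in> space M. (\<forall>i<n. Y i w \<in> A) \<and> Y n w = s} * P s s')"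
proof -
  note [measurable] = meas
  define R where "R = PiE {..n} (\<lambda>_. A)"
  have finA: "finite A" using A fin finite_subset by blast
  then have R: "finite R" "R \<subseteq> extensional {..n}"
    unfolding R_def using PiE_iff by (blast intro: finite_PiE)+
  have inR: "restrict (\<lambda>i. Y i w) {..n} \<in> R \<longleftrightarrow> (\<forall>i\<le>n. Y i w \<in> A)" for w
    by (auto simp: R_def PiE_def Pi_def)
  have one: "prob {w \<in> space M. (\<forall>i\<le>n. Y i w = \<sigma> i) \<and> Y (Suc n) w = s'} =
      prob {w \<in> space M. \<forall>i\<le>n. Y i w = \<sigma> i} * P (\<sigma> n) s'" if "\<sigma> \<in> R" for \<sigma>
  proof -
    \<comment> \<open>The hypothesis asks for an infinite sequence in \<open>S\<close>; repeating
      \<open>s'\<close> after time \<open>n\<close> extends the segment \<sigma> to one.\<close>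
    define s where "s i = (if i \<le> n then \<sigma> i else s')" for i
    have "range s \<subseteq> S"
      using that A s' by (auto simp: s_def R_def PiE_def Pi_def)
    note markov[OF this, of n]
    moreover have "(\<forall>i\<le>Suc n. Y i w = s i) \<longleftrightarrow> (\<forall>i\<le>n. Y i w = \<sigma> i) \<and> Y (Suc n) w = s'" for w
      unfolding s_def le_Suc_eq by auto
    moreover have "(\<forall>i\<le>n. Y i w = s i) \<longleftrightarrow> (\<forall>i\<le>n. Y i w = \<sigma> i)" for w
      unfolding s_def by auto
    ultimately show ?thesis by (simp add: s_def)
  qed
  have "prob {w \<in> space M. (\<forall>i\<le>n. Y i w \<in> A) \<and> Y (Suc n) w = s'} =
     (\<Sum>\<sigma>\<in>R. prob {w \<in> space M. \<forall>i\<le>n. Y i w = \<sigma> i} * P (\<sigma> n) s')"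
    using prob_path_sum[where Y=Y and V="\<lambda>w. Y (Suc n) w = s'", OF R meas] by (simp add: inR one)
  also have "\<dots> = (\<Sum>s\<in>A. \<Sum>\<sigma>\<in>{\<sigma>\<in>R. \<sigma> n = s}. prob {w \<in> space M. \<forall>i\<le>n. Y i w = \<sigma> i} * P (\<sigma> n) s')"
    by (rule sum.group[symmetric, OF R(1) finA]) (auto simp: R_def)
  also have "\<dots> = (\<Sum>s\<in>A. prob {w \<in> space M. (\<forall>i<n. Y i w \<in> A) \<and> Y n w = s} * P s s')"
  proof (rule sum.cong[OF refl])
    fix s assume s: "s \<in> A"
    define R' where "R' = {\<sigma>\<in>R. \<sigma> n = s}"
    have R': "finite R'" "R' \<subseteq> extensional {..n}" using R by (auto simp: R'_def)
    have "restrict (\<lambda>i. Y i w) {..n} \<in> R' \<longleftrightarrow> (\<forall>i<n. Y i w \<in> A) \<and> Y n w = s" for w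
      using s by (auto simp: R'_def inR le_less)
    then show "(\<Sum>\<sigma>\<in>{\<sigma>\<in>R. \<sigma> n = s}. prob {w \<in> space M. \<forall>i\<le>n. Y i w = \<sigma> i} * P (\<sigma> n) s') =
        prob {w \<in> space M. (\<forall>i<n. Y i w \<in> A) \<and> Y n w = s} * P s s'"
      using prob_path_sum[where Y=Y and V="\<lambda>w. True", OF R' meas]
      by (simp add: sum_distrib_right R'_def)
  qed
  finally show ?thesis .
qed

text \<open>
  The sum telescopes because \<open>c P f = f\<close> holds off the target up to the one-step defect \<open>\<delta>\<close>; the
  term \<open>c ^ n * K\<close> accounts for the paths that have not hit the target before step \<open>n\<close>.
\<close>
lemma (in prob_space) discounted_hitting_sum:
  fixes Y :: "nat \<Rightarrow> 'a \<Rightarrow> nat" and f :: "nat \<Rightarrow> real"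
  assumes fin: "finite S" and y: "y \<in> S" and z: "z \<in> S" and c: "0 < c" "c < 1" and \<delta>: "0 \<le> \<delta>"
    and meas: "\<And>i. Y i \<in> M \<rightarrow>\<^sub>M count_space UNIV"
    and inS: "\<And>i w. w \<in> space M \<Longrightarrow> Y i w \<in> S"
    and start: "AE w in M. Y 0 w = z"
    and markov: "\<And>n s. range s \<subseteq> S \<Longrightarrow>
      prob {w \<in> space M. \<forall>i\<le>Suc n. Y i w = s i} =
      prob {w \<in> space M. \<forall>i\<le>n. Y i w = s i} * P (s n) (s (Suc n))"
    and defect: "\<And>s. s \<in> S - {y} \<Longrightarrow> \<bar>c * (\<Sum>s'\<in>S. P s s' * f s') - f s\<bar> \<le> \<delta>"
    and bound: "\<And>s. s \<in> S \<Longrightarrow> \<bar>f s\<bar> \<le> K"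
  shows "\<bar>(\<Sum>k<n. c ^ k * (f y * prob {w \<in> space M. (\<forall>i<k. Y i w \<noteq> y) \<and> Y k w = y})) - f z\<bar>
     \<le> c ^ n * K + \<delta> / (1 - c)"
proof -
  note [measurable] = meas
  \<comment> \<open>\<open>Q k\<close> is the law of \<open>Y k\<close> restricted to paths without
    a visit to \<open>y\<close> before step \<open>k\<close>. It keeps the mass at \<open>y\<close>,
    which is the first-hit mass of step \<open>k\<close>.\<close>
  define Q where "Q k s = prob {w \<in> space M. (\<forall>i<k. Y i w \<noteq> y) \<and> Y k w = s}" for k s
  have Qnn: "0 \<le> Q k s" for k s by (simp add: Q_def)
  have Qsum: "(\<Sum>s\<in>B. Q k s) \<le> 1" if "B \<subseteq> S" for k B
  proof -
    have fB: "finite B" using that fin finite_subset by blast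
    have "(\<Sum>s\<in>B. Q k s) = prob (\<Union>s\<in>B. {w \<in> space M. (\<forall>i<k. Y i w \<noteq> y) \<and> Y k w = s})"
      unfolding Q_def using fB
      by (intro finite_measure_finite_Union[symmetric]) (auto simp: disjoint_family_on_def)
    also have "\<dots> \<le> 1" by simp
    finally show ?thesis .
  qed
  have step: "Q (Suc k) s' = (\<Sum>s\<in>S - {y}. Q k s * P s s')" if "s' \<in> S" for k s'
  proof -
    have e1: "{w \<in> space M. (\<forall>i\<le>k. Y i w \<in> S - {y}) \<and> Y (Suc k) w = s'} =
        {w \<in> space M. (\<forall>i<Suc k. Y i w \<noteq> y) \<and> Y (Suc k) w = s'}"
      using inS by (auto simp: less_Suc_eq_le)
    have e2: "{w \<in> space M. (\<forall>i<k. Y i w \<in> S - {y}) \<and> Y k w = s} =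
        {w \<in> space M. (\<forall>i<k. Y i w \<noteq> y) \<and> Y k w = s}" for s
      using inS by auto
    show ?thesis
      using prob_taboo_step[where Y=Y and P=P and A="S - {y}" and n=k, OF fin Diff_subset that meas markov] 
      unfolding Q_def e1 e2 by simp
  qed
  \<comment> \<open>The discounted mean of \<open>f\<close> under \<open>Q k\<close>. One step
    removes the mass at \<open>y\<close> and moves the rest by \<open>P\<close>, so
    \<open>a k - a (Suc k)\<close> is the discounted first-hit mass times \<open>f y\<close>, up to
    the defect.\<close>
  define a where "a k = c ^ k * (\<Sum>s\<in>S. Q k s * f s)" for k
  have a0: "a 0 = f z"
  proof -
    have "Q 0 s = of_bool (s = z)" for s
    proof (cases "s = z")
      case True
      then show ?thesis using start prob_Collect_eq_1[of "\<lambda>w. Y 0 w = z"]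
        by (simp add: Q_def)
    next
      case False
      then have "AE w in M. Y 0 w \<noteq> s" using start by auto
      then show ?thesis using False prob_Collect_eq_0[of "\<lambda>w. Y 0 w = s"]
        by (simp add: Q_def)
    qed
    then have "(\<Sum>s\<in>S. Q 0 s * f s) = (\<Sum>s\<in>S. if s = z then f s else 0)"
      by (intro sum.cong) auto
    then show ?thesis using fin z by (simp add: a_def)
  qed
  have astep: "\<bar>c ^ k * (f y * Q k y) - (a k - a (Suc k))\<bar> \<le> c ^ k * \<delta>" for k
  proof -
    have e: "a k = c ^ k * (Q k y * f y + (\<Sum>s\<in>S - {y}. Q k s * f s))"
      unfolding a_def using fin y by (subst sum.remove[of S y]) auto
    have "(\<Sum>s'\<in>S. Q (Suc k) s' * f s') = (\<Sum>s'\<in>S. \<Sum>s\<in>S - {y}. Q k s * P s s' * f s')"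
      by (intro sum.cong refl) (simp add: step sum_distrib_right)
    also have "\<dots> = (\<Sum>s\<in>S - {y}. Q k s * (\<Sum>s'\<in>S. P s s' * f s'))"
      by (subst sum.swap) (simp add: sum_distrib_left mult.assoc)
    finally have "a (Suc k) = c ^ k * (\<Sum>s\<in>S - {y}. Q k s * (c * (\<Sum>s'\<in>S. P s s' * f s')))"
      by (simp add: a_def sum_distrib_left mult_ac)
    then have "c ^ k * (f y * Q k y) - (a k - a (Suc k)) =
       c ^ k * (\<Sum>s\<in>S - {y}. Q k s * (c * (\<Sum>s'\<in>S. P s s' * f s') - f s))"
      unfolding e by (simp add: algebra_simps sum_subtractf)
    also have "\<bar>\<dots>\<bar> \<le> c ^ k * (\<Sum>s\<in>S - {y}. Q k s * \<delta>)"
      unfolding abs_mult using c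
      by (intro mult_mono order_trans[OF sum_abs] sum_mono)
         (auto simp: abs_mult Qnn intro!: mult_left_mono defect)
    also have "\<dots> \<le> c ^ k * \<delta>"
      using mult_right_mono[OF Qsum[of "S - {y}" k] \<delta>] c
      by (simp add: sum_distrib_right)
    finally show ?thesis .
  qed
  have "(\<Sum>k<n. c ^ k * (f y * Q k y)) - f z =
      (\<Sum>k<n. c ^ k * (f y * Q k y) - (a k - a (Suc k))) - a n"
    using sum_lessThan_telescope'[of a n] a0 by (simp only: sum_subtractf)
  also have "\<bar>\<dots>\<bar> \<le> (\<Sum>k<n. c ^ k * \<delta>) + \<bar>a n\<bar>"
    by (intro order_trans[OF abs_triangle_ineq4] add_mono order_trans[OF sum_abs] sum_mono astep) auto
  also have "\<bar>a n\<bar> \<le> c ^ n * K"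
  proof -
    have "\<bar>\<Sum>s\<in>S. Q n s * f s\<bar> \<le> (\<Sum>s\<in>S. Q n s * K)"
      by (intro order_trans[OF sum_abs] sum_mono) (auto simp: abs_mult Qnn intro!: mult_left_mono bound)
    also have "\<dots> \<le> 1 * K"
      unfolding sum_distrib_right[symmetric] using bound[OF y] by (intro mult_right_mono Qsum) auto
    finally show ?thesis using c by (simp add: a_def abs_mult)
  qed
  also have "(\<Sum>k<n. c ^ k * \<delta>) \<le> \<delta> / (1 - c)"
  proof -
    have "(\<Sum>k<n. c ^ k) \<le> 1 / (1 - c)"
      using c by (simp add: sum_gp_strict divide_right_mono)
    from mult_right_mono[OF this \<delta>] show ?thesis by (simp add: sum_distrib_right)
  qed
  finally show ?thesis unfolding Q_def by simp
qed

section \<open>First visits of a path seen on a grid\<close>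

lemma first_hit_sum_eq:
  fixes Y :: "nat \<Rightarrow> 'a" and n :: nat
  shows "(\<Sum>k<n. of_bool ((\<forall>i<k. Y i \<noteq> y) \<and> Y k = y)) = (of_bool (\<exists>k<n. Y k = y) :: real)"
  by (induction n) (auto simp: less_Suc_eq)

lemma discounted_first_hit_sum_le_1:
  fixes c :: real
  assumes "0 \<le> c" "c \<le> 1"
  shows "(\<Sum>k<n. c ^ k * of_bool ((\<forall>i<k. Y i \<noteq> y) \<and> Y k = y)) \<le> 1"
proof -
  have "(\<Sum>k<n. c ^ k * of_bool ((\<forall>i<k. Y i \<noteq> y) \<and> Y k = y)) \<le>
      (\<Sum>k<n. of_bool ((\<forall>i<k. Y i \<noteq> y) \<and> Y k = y))"
    using assms by (intro sum_mono) (auto simp: power_le_one)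
  also have "\<dots> \<le> 1" unfolding first_hit_sum_eq by simp
  finally show ?thesis .
qed

text \<open>Right-continuity does two things: a visit just after the infimum \<open>t\<close> shows
  the same state as \<open>t\<close> itself, so the infimum is attained; and this state persists for
  a while, so a fine grid cannot miss it.\<close>

lemma hitting_time_attained:
  fixes X :: "real \<Rightarrow> 'w \<Rightarrow> nat"
  assumes rc: "\<And>t. t \<ge> 0 \<Longrightarrow> continuous (at_right t) (\<lambda>s. X s w)"
    and hit: "s \<ge> 0" "X s w = y"
  obtains t e where "t \<ge> 0" "e > 0" "hitting_time X y w = ereal t"
    "\<And>s. 0 \<le> s \<Longrightarrow> s < t \<Longrightarrow> X s w \<noteq> y" "\<And>s. t \<le> s \<Longrightarrow> s < t + e \<Longrightarrow> X s w = y"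
proof -
  define H where "H = {s. 0 \<le> s \<and> X s w = y}"
  define t where "t = Inf H"
  have ne: "H \<noteq> {}" and bd: "bdd_below H" using hit by (auto simp: H_def intro!: bdd_belowI[of _ 0])
  have lower: "t \<le> s" if "s \<in> H" for s using bd that by (simp add: t_def cInf_lower)
  have t0: "0 \<le> t" unfolding t_def using ne by (intro cInf_greatest) (auto simp: H_def)
  have "eventually (\<lambda>s. X s w = X t w) (at_right t)"
    using rc[OF t0] by (simp add: continuous_within tendsto_discrete)
  then obtain b where b: "b > t" "\<And>s. t < s \<Longrightarrow> s < b \<Longrightarrow> X s w = X t w"
    by (auto simp: eventually_at_right_field)
  obtain s' where s': "s' \<in> H" "s' < b"
    using b(1) cInf_less_iff[OF ne bd] unfolding t_def by blast
  have Xt: "X t w = y"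
    using lower[OF s'(1)] s' b(2)[of s'] by (cases "s' = t") (auto simp: H_def)
  have ht: "hitting_time X y w = ereal t"
    unfolding hitting_time_def H_def[symmetric]
  proof (rule antisym)
    show "(INF s\<in>H. ereal s) \<le> ereal t" using Xt t0 by (intro INF_lower) (simp add: H_def)
    show "ereal t \<le> (INF s\<in>H. ereal s)" using lower by (intro INF_greatest) simp
  qed
  show ?thesis
  proof (rule that[of t "b - t"])
    show "X s w \<noteq> y" if "0 \<le> s" "s < t" for s using lower[of s] that by (auto simp: H_def)
    show "X s w = y" if "t \<le> s" "s < t + (b - t)" for s
      using b(2)[of s] Xt that by (cases "s = t") auto
  qed (use t0 b ht in auto)
qed

text \<open>Once the mesh is shorter than the stay beginning at the hitting time, the first grid
  visit is at the first grid point not before that time. The steps cover all times below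
  \<open>n + 1\<close>, so every finite hitting time is eventually in range. A path without a visit
  gives 0 on both sides.\<close>

lemma discretized_hitting_tendsto:
  fixes X :: "real \<Rightarrow> 'w \<Rightarrow> nat" and \<alpha> :: real
  assumes rc: "\<And>t. t \<ge> 0 \<Longrightarrow> continuous (at_right t) (\<lambda>s. X s w)"
  shows "(\<lambda>n. \<Sum>k<Suc n * Suc n. exp (- \<alpha> / real (Suc n)) ^ k *
      of_bool ((\<forall>i<k. X (real i / real (Suc n)) w \<noteq> y) \<and> X (real k / real (Suc n)) w = y))
    \<longlonglongrightarrow> exp_neg \<alpha> (hitting_time X y w)"
    (is "?G \<longlonglongrightarrow> _")
proof (cases "\<exists>s\<ge>0. X s w = y")
  case False
  then have "{s. 0 \<le> s \<and> X s w = y} = {}" by auto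
  then have "hitting_time X y w = \<infinity>"
    unfolding hitting_time_def by (simp only: image_empty Inf_empty top_ereal_def)
  moreover have "?G = (\<lambda>_. 0)" using False by (auto intro!: sum.neutral)
  ultimately show ?thesis by (simp add: exp_neg_def)
next
  case True
  then obtain t e where te: "t \<ge> 0" "e > 0" "hitting_time X y w = ereal t"
    "\<And>s. 0 \<le> s \<Longrightarrow> s < t \<Longrightarrow> X s w \<noteq> y" "\<And>s. t \<le> s \<Longrightarrow> s < t + e \<Longrightarrow> X s w = y"
    using hitting_time_attained[of X w _ y] rc by metis
  define k where "k n = nat \<lceil>t * real (Suc n)\<rceil>" for n
  have kb: "t * real (Suc n) \<le> real (k n)" "real (k n) < t * real (Suc n) + 1" for n
  proof -
    have "0 \<le> t * real (Suc n)" using te(1) by simp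
    then have "real (k n) = of_int \<lceil>t * real (Suc n)\<rceil>" unfolding k_def by simp
    then show "t * real (Suc n) \<le> real (k n)" "real (k n) < t * real (Suc n) + 1" by linarith+
  qed
  have kd: "t \<le> real (k n) / real (Suc n)" "real (k n) / real (Suc n) < t + 1 / real (Suc n)" for n
  proof -
    have "real (k n) / real (Suc n) < (t * real (Suc n) + 1) / real (Suc n)"
      by (rule divide_strict_right_mono[OF kb(2)]) simp
    then show "real (k n) / real (Suc n) < t + 1 / real (Suc n)" by (simp add: add_divide_distrib)
    show "t \<le> real (k n) / real (Suc n)" using kb(1)[of n] by (subst pos_le_divide_eq) auto
  qed
  have small: "\<forall>\<^sub>F n in sequentially. 1 / real (Suc n) < e"
    using te(2) order_tendstoD(2)[OF LIMSEQ_inverse_real_of_nat] by (simp add: inverse_eq_divide)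
  \<comment> \<open>This puts \<open>k n\<close> inside the range of summation: k n < t (n + 1) + 1
    \<le> (t + 1) (n + 1) < (n + 1)^2.\<close>
  have large: "\<forall>\<^sub>F n in sequentially. t + 1 < real (Suc n)"
    by real_asymp
  have ev: "\<forall>\<^sub>F n in sequentially. exp (- \<alpha> * (real (k n) / real (Suc n))) = ?G n"
    using small large
  proof eventually_elim
    case (elim n)
    let ?m = "real (Suc n)"
    have kn: "k n < Suc n * Suc n"
    proof -
      have "real (k n) < t * ?m + 1" by (rule kb)
      also have "\<dots> \<le> (t + 1) * ?m" by (simp add: algebra_simps)
      also have "\<dots> < ?m * ?m" using elim(2) by (intro mult_strict_right_mono) auto
      finally show ?thesis by (metis of_nat_less_iff of_nat_mult)
    qed
    have hitk: "X (real (k n) / ?m) w = y"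
      using kd[of n] elim(1) by (intro te(5)) auto
    have before: "X (real i / ?m) w \<noteq> y" if "i < k n" for i
    proof (rule te(4))
      have "real i + 1 \<le> real (k n)" using that by linarith
      then have "real i < t * ?m" using kb(2)[of n] by linarith
      then show "real i / ?m < t" by (simp add: field_simps)
    qed simp
    have "?G n = (\<Sum>j<Suc n * Suc n. if j = k n then exp (- \<alpha> / ?m) ^ k n else 0)"
    proof (intro sum.cong refl)
      fix j
      show "exp (- \<alpha> / ?m) ^ j * of_bool ((\<forall>i<j. X (real i / ?m) w \<noteq> y) \<and> X (real j / ?m) w = y) =
          (if j = k n then exp (- \<alpha> / ?m) ^ k n else 0)"
        using before hitk by (cases j "k n" rule: linorder_cases) auto
    qed
    also have "\<dots> = exp (- \<alpha> / ?m) ^ k n" using kn by simp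
    also have "\<dots> = exp (- \<alpha> * (real (k n) / ?m))"
      by (simp add: exp_of_nat_mult[symmetric])
    finally show ?case by simp
  qed
  have "(\<lambda>n. real (k n) / real (Suc n)) \<longlonglongrightarrow> t"
  proof (rule tendsto_sandwich)
    show "\<forall>\<^sub>F n in sequentially. t \<le> real (k n) / real (Suc n)" using kd(1) by simp
    show "\<forall>\<^sub>F n in sequentially. real (k n) / real (Suc n) \<le> t + 1 / real (Suc n)"
      using kd(2) by (intro always_eventually allI less_imp_le)
    show "(\<lambda>n. t + 1 / real (Suc n)) \<longlonglongrightarrow> t" by real_asymp
  qed simp
  then have "(\<lambda>n. exp (- \<alpha> * (real (k n) / real (Suc n)))) \<longlonglongrightarrow> exp (- \<alpha> * t)"
    by (intro tendsto_intros)
  then have "?G \<longlonglongrightarrow> exp (- \<alpha> * t)"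
    by (rule Lim_transform_eventually[OF _ ev])
  then show ?thesis by (simp add: te(3) exp_neg_def)
qed

text \<open>The infimum runs over uncountably many times; measurability comes from the pointwise
  limit, whose terms look at finitely many times each.\<close>

lemma measurable_exp_neg_hitting_time:
  assumes ctmc: "ctmc M S q z X"
  shows "(\<lambda>w. exp_neg \<alpha> (hitting_time X y w)) \<in> borel_measurable M"
proof (rule borel_measurable_LIMSEQ_real)
  fix w assume "w \<in> space M"
  then show "(\<lambda>n. \<Sum>k<Suc n * Suc n. exp (- \<alpha> / real (Suc n)) ^ k *
    of_bool ((\<forall>i<k. X (real i / real (Suc n)) w \<noteq> y) \<and> X (real k / real (Suc n)) w = y))
  \<longlonglongrightarrow> exp_neg \<alpha> (hitting_time X y w)"
    using ctmc by (intro discretized_hitting_tendsto) (auto simp: ctmc_def)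
next
  have [measurable]: "X (real i / real (Suc n)) \<in> M \<rightarrow>\<^sub>M count_space UNIV" for i n
    using ctmc by (simp add: ctmc_def)
  show "(\<lambda>w. \<Sum>k<Suc n * Suc n. exp (- \<alpha> / real (Suc n)) ^ k *
    of_bool ((\<forall>i<k. X (real i / real (Suc n)) w \<noteq> y) \<and> X (real k / real (Suc n)) w = y))
    \<in> borel_measurable M" for n
    by measurable
qed

section \<open>From the generator equation to the Laplace transform\<close>

text \<open>This is the derivative at 0 of exp (-\<alpha> h) P_h f, namely Q f - \<alpha> f. Since
  rates are given off the diagonal, the row sum 1 is used to write everything through the
  differences \<open>f s' - f s\<close>.\<close>

lemma one_step_defect_tendsto:
  fixes f :: "'s \<Rightarrow> real"
  assumes fin: "finite S" and p: "transition_function S p" and q: "has_transition_rates S q p"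
    and s: "s \<in> S"
    and gen: "(\<Sum>s'\<in>S - {s}. q s s' * (f s' - f s)) = \<alpha> * f s"
  shows "((\<lambda>h. (exp (- \<alpha> * h) * (\<Sum>s'\<in>S. p h s s' * f s') - f s) / h) \<longlongrightarrow> 0) (at_right 0)"
proof -
  have lim: "((\<lambda>h. \<Sum>s'\<in>S - {s}. p h s s' / h * (f s' - f s)) \<longlongrightarrow> \<alpha> * f s) (at_right 0)"
    unfolding gen[symmetric]
    using q s by (intro tendsto_sum tendsto_mult tendsto_const) (auto simp: has_transition_rates_def)
  have e0: "((\<lambda>h. exp (- \<alpha> * h)) \<longlongrightarrow> 1) (at_right 0)"
    by real_asymp
  have e1: "((\<lambda>h. (exp (- \<alpha> * h) - 1) / h) \<longlongrightarrow> - \<alpha>) (at_right 0)"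
    by real_asymp
  have "((\<lambda>h. exp (- \<alpha> * h) * (\<Sum>s'\<in>S - {s}. p h s s' / h * (f s' - f s)) +
       (exp (- \<alpha> * h) - 1) / h * f s) \<longlongrightarrow> 1 * (\<alpha> * f s) + - \<alpha> * f s) (at_right 0)"
    by (intro tendsto_intros lim e0 e1)
  then have "((\<lambda>h. exp (- \<alpha> * h) * (\<Sum>s'\<in>S - {s}. p h s s' / h * (f s' - f s)) +
       (exp (- \<alpha> * h) - 1) / h * f s) \<longlongrightarrow> 0) (at_right 0)" by simp
  then show ?thesis
  proof (rule Lim_transform_eventually)
    show "\<forall>\<^sub>F h in at_right 0. exp (- \<alpha> * h) * (\<Sum>s'\<in>S - {s}. p h s s' / h * (f s' - f s)) +
       (exp (- \<alpha> * h) - 1) / h * f s = (exp (- \<alpha> * h) * (\<Sum>s'\<in>S. p h s s' * f s') - f s) / h"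
      using eventually_at_right_less
    proof eventually_elim
      case (elim h)
      have one: "(\<Sum>s'\<in>S. p h s s') = 1" using p s elim by (auto simp: transition_function_def)
      have "(\<Sum>s'\<in>S - {s}. p h s s' * (f s' - f s)) = (\<Sum>s'\<in>S. p h s s' * (f s' - f s))"
        using fin s by (simp add: sum.remove[of S s])
      also have "\<dots> = (\<Sum>s'\<in>S. p h s s' * f s') - f s"
        by (simp add: right_diff_distrib sum_subtractf sum_distrib_right[symmetric] one)
      finally have eq: "(\<Sum>s'\<in>S - {s}. p h s s' / h * (f s' - f s)) =
          ((\<Sum>s'\<in>S. p h s s' * f s') - f s) / h"
        by (simp add: sum_divide_distrib[symmetric])
      show ?case unfolding eq using elim by (simp add: field_simps)
    qed
  qed
qed

lemma hitting_laplace_eqI: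
  fixes f :: "nat \<Rightarrow> real"
  assumes ctmc: "ctmc M S q z X" and fin: "finite S" and y: "y \<in> S" and z: "z \<in> S" and \<alpha>: "\<alpha> > 0"
    and fy: "f y = 1"
    and gen: "\<And>s. s \<in> S - {y} \<Longrightarrow> (\<Sum>s'\<in>S - {s}. q s s' * (f s' - f s)) = \<alpha> * f s"
  shows "hitting_laplace M X y \<alpha> = f z"
proof -
  interpret prob_space M using ctmc by (simp add: ctmc_def)
  obtain p where p: "transition_function S p" "has_transition_rates S q p" "markov_property M S p X"
    using ctmc by (auto simp: ctmc_def)
  define h where "h n = 1 / real (Suc n)" for n
  define Y where "Y n i = X (real i / real (Suc n))" for n i
  define G where "G n w = (\<Sum>k<Suc n * Suc n. exp (- \<alpha> / real (Suc n)) ^ k *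
      of_bool ((\<forall>i<k. Y n i w \<noteq> y) \<and> Y n k w = y))" for n w
  have Ym [measurable]: "Y n i \<in> M \<rightarrow>\<^sub>M count_space UNIV" for n i
    unfolding Y_def using ctmc by (simp add: ctmc_def)
  have inS: "Y n i w \<in> S" if "w \<in> space M" for n i w
    using ctmc that by (simp add: Y_def ctmc_def)
  have start: "AE w in M. Y n 0 w = z" for n
    using ctmc by (simp add: Y_def ctmc_def)
  have markov: "prob {w \<in> space M. \<forall>i\<le>Suc m. Y n i w = s i} =
      prob {w \<in> space M. \<forall>i\<le>m. Y n i w = s i} * p (h n) (s m) (s (Suc m))" if "range s \<subseteq> S" for n m s
  proof -
    have "mono (\<lambda>i. real i / real (Suc n))" by (intro monoI divide_right_mono) auto
    moreover have "real (Suc m) / real (Suc n) - real m / real (Suc n) = h n"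
      by (simp add: h_def diff_divide_distrib[symmetric])
    ultimately show ?thesis
      using p(3)[unfolded markov_property_def, rule_format, of "\<lambda>i. real i / real (Suc n)" s m] that
      by (simp add: Y_def)
  qed
  have G_lim: "(\<lambda>n. G n w) \<longlonglongrightarrow> exp_neg \<alpha> (hitting_time X y w)" if "w \<in> space M" for w
    unfolding G_def Y_def using ctmc that
    by (intro discretized_hitting_tendsto) (auto simp: ctmc_def)
  have G_meas [measurable]: "G n \<in> borel_measurable M" for n
    unfolding G_def by measurable
  have G_bd: "norm (G n w) \<le> 1" for n w
  proof -
    have "0 \<le> G n w" unfolding G_def by (intro sum_nonneg) auto
    moreover have "G n w \<le> 1"
      unfolding G_def using \<alpha> by (intro discounted_first_hit_sum_le_1) auto
    ultimately show ?thesis by simp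
  qed
  note T_meas = measurable_exp_neg_hitting_time[OF ctmc]
  have "(\<lambda>n. LINT w|M. G n w) \<longlonglongrightarrow> (LINT w|M. exp_neg \<alpha> (hitting_time X y w))"
    by (rule integral_dominated_convergence[where w="\<lambda>_. 1"])
       (use T_meas G_lim G_bd in auto)
  moreover have "(\<lambda>n. LINT w|M. G n w) \<longlonglongrightarrow> f z"
  proof -
    define c where "c n = exp (- \<alpha> * h n)" for n
    \<comment> \<open>A sum over the states bounds each single defect and is o(t) as a finite sum of
      such terms.\<close>
    define \<delta> where "\<delta> t = (\<Sum>s\<in>S - {y}. \<bar>exp (- \<alpha> * t) * (\<Sum>s'\<in>S. p t s s' * f s') - f s\<bar>)" for t
    define K where "K = (\<Sum>s\<in>S. \<bar>f s\<bar>)"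
    have c: "0 < c n" "c n < 1" for n using \<alpha> by (auto simp: c_def h_def)
    have EG: "(LINT w|M. G n w) =
        (\<Sum>k<Suc n * Suc n. c n ^ k * (f y * prob {w \<in> space M. (\<forall>i<k. Y n i w \<noteq> y) \<and> Y n k w = y}))" for n
    proof -
      have "(LINT w|M. G n w) = (\<Sum>k<Suc n * Suc n. LINT w|M. c n ^ k *
          of_bool ((\<forall>i<k. Y n i w \<noteq> y) \<and> Y n k w = y))"
        unfolding G_def c_def h_def
        by (subst Bochner_Integration.integral_sum)
           (auto intro!: integrable_const_bound[where B=1] simp: power_le_one \<alpha> less_imp_le)
      also have "\<dots> = (\<Sum>k<Suc n * Suc n. c n ^ k * (f y * prob {w \<in> space M. (\<forall>i<k. Y n i w \<noteq> y) \<and> Y n k w = y}))"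
      proof (intro sum.cong refl)
        fix k
        have "(LINT w|M. of_bool ((\<forall>i<k. Y n i w \<noteq> y) \<and> Y n k w = y) :: real) =
           (LINT w|M. indicator {w \<in> space M. (\<forall>i<k. Y n i w \<noteq> y) \<and> Y n k w = y} w)"
          by (intro Bochner_Integration.integral_cong) (auto simp: indicator_def)
        then show "(LINT w|M. c n ^ k * of_bool ((\<forall>i<k. Y n i w \<noteq> y) \<and> Y n k w = y)) =
           c n ^ k * (f y * prob {w \<in> space M. (\<forall>i<k. Y n i w \<noteq> y) \<and> Y n k w = y})"
          by (simp add: fy)
      qed
      finally show ?thesis .
    qed
    have err: "\<bar>(LINT w|M. G n w) - f z\<bar> \<le> c n ^ (Suc n * Suc n) * K + \<delta> (h n) / (1 - c n)" for n
      unfolding EG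
    proof (rule discounted_hitting_sum[where S=S and P="p (h n)", OF fin y z c])
      show "0 \<le> \<delta> (h n)" by (simp add: \<delta>_def sum_nonneg)
      show "\<bar>c n * (\<Sum>s'\<in>S. p (h n) s s' * f s') - f s\<bar> \<le> \<delta> (h n)" if "s \<in> S - {y}" for s
        unfolding \<delta>_def c_def using fin that by (intro member_le_sum) auto
      show "\<bar>f s\<bar> \<le> K" if "s \<in> S" for s
        unfolding K_def using fin that by (intro member_le_sum) auto
    qed (use inS start markov in auto)
    have "((\<lambda>t. \<Sum>s\<in>S - {y}. \<bar>(exp (- \<alpha> * t) * (\<Sum>s'\<in>S. p t s s' * f s') - f s) / t\<bar>)
        \<longlongrightarrow> (\<Sum>s\<in>S - {y}. 0)) (at_right 0)"
      using one_step_defect_tendsto[OF fin p(1,2) _ gen]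
      by (intro tendsto_sum tendsto_rabs_zero) auto
    moreover have "filterlim h (at_right 0) sequentially" unfolding h_def by real_asymp
    ultimately have "(\<lambda>n. \<Sum>s\<in>S - {y}. \<bar>(exp (- \<alpha> * h n) * (\<Sum>s'\<in>S. p (h n) s s' * f s') - f s) / h n\<bar>)
        \<longlonglongrightarrow> 0"
      by (auto dest: filterlim_compose)
    moreover have "h n > 0" for n by (simp add: h_def)
    ultimately have \<delta>_lim: "(\<lambda>n. \<delta> (h n) / h n) \<longlonglongrightarrow> 0"
      by (simp add: \<delta>_def sum_divide_distrib abs_divide less_imp_le)
    \<comment> \<open>The geometric factor \<open>1 / (1 - c n)\<close> grows like 1 / (\<alpha> h),
      so defects of size o(h) remain negligible after summation.\<close>
    have "(\<lambda>n. h n / (1 - c n)) \<longlonglongrightarrow> 1 / \<alpha>"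
      unfolding h_def c_def using \<alpha> by (real_asymp simp: inverse_eq_divide)
    from tendsto_mult[OF \<delta>_lim this] have "(\<lambda>n. \<delta> (h n) / (1 - c n)) \<longlonglongrightarrow> 0"
      by (simp add: h_def)
    moreover have "(\<lambda>n. c n ^ (Suc n * Suc n)) \<longlonglongrightarrow> 0"
    proof -
      have "c n ^ (Suc n * Suc n) = exp (- \<alpha> * real (Suc n))" for n
      proof -
        have "real (Suc n * Suc n) * (- \<alpha> * h n) = - \<alpha> * real (Suc n)"
          unfolding h_def of_nat_mult by (simp del: of_nat_Suc)
        then show ?thesis unfolding c_def by (simp only: exp_of_nat_mult[symmetric])
      qed
      then show ?thesis using \<alpha> by simp real_asymp
    qed
    ultimately have "(\<lambda>n. c n ^ (Suc n * Suc n) * K + \<delta> (h n) / (1 - c n)) \<longlonglongrightarrow> 0 * K + 0"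
      by (intro tendsto_intros)
    then have "(\<lambda>n. (LINT w|M. G n w) - f z) \<longlonglongrightarrow> 0"
      by (intro Lim_null_comparison[OF _ tendsto_eq_rhs]) (use err in auto)
    then show ?thesis by (simp add: LIM_zero_iff)
  qed
  ultimately show ?thesis
    unfolding hitting_laplace_def by (rule LIMSEQ_unique)
qed

text \<open>The telescoping estimate needs a discount below 1, so \<alpha> = 0 is treated as a
  limit. On paths without a visit \<open>exp_neg\<close> is 0 for every \<alpha>, which makes it
  continuous in \<alpha> there too.\<close>

lemma hitting_laplace_tendsto_zero:
  assumes ctmc: "ctmc M S q z X"
  shows "(\<lambda>n. hitting_laplace M X y (1 / real (Suc n))) \<longlonglongrightarrow> hitting_laplace M X y 0"
proof -
  interpret prob_space M using ctmc by (simp add: ctmc_def)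
  note meas = measurable_exp_neg_hitting_time[OF ctmc]
  have nonneg: "0 \<le> hitting_time X y w" for w
    unfolding hitting_time_def by (intro INF_greatest) auto
  show ?thesis
    unfolding hitting_laplace_def
  proof (rule integral_dominated_convergence[where w="\<lambda>_. 1"])
    show "AE w in M. (\<lambda>n. exp_neg (1 / real (Suc n)) (hitting_time X y w)) \<longlonglongrightarrow> exp_neg 0 (hitting_time X y w)"
    proof (rule AE_I2)
      fix w
      have "(\<lambda>n. exp (- (1 / real (Suc n)) * r)) \<longlonglongrightarrow> 1" for r :: real by real_asymp
      then show "(\<lambda>n. exp_neg (1 / real (Suc n)) (hitting_time X y w)) \<longlonglongrightarrow> exp_neg 0 (hitting_time X y w)"
        by (cases "hitting_time X y w = \<infinity>") (simp_all add: exp_neg_def)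
    qed
    show "AE w in M. norm (exp_neg (1 / real (Suc n)) (hitting_time X y w)) \<le> 1" for n
      using nonneg by (auto simp: exp_neg_def real_of_ereal_pos)
  qed (use meas in auto)
qed

section \<open>The integrals B, D, b and d\<close>

text \<open>The gauge integral supplies the value; nonnegativity turns it into absolute
  integrability, which passes from the completed measure to \<open>lborel\<close> for Borel
  functions.\<close>

lemma LBINT_powr_0_1:
  fixes a :: real
  assumes a: "a > -1"
  shows "set_integrable lborel {0..1} (\<lambda>u. u powr a)" "(LBINT u:{0..1}. u powr a) = 1 / (a + 1)"
proof -
  have hi: "((\<lambda>u. u powr a) has_integral (1 / (a + 1))) {0..1}"
    using has_integral_powr_from_0[OF a, of 1] by simp
  then have "(\<lambda>u. u powr a) absolutely_integrable_on {0..1}"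
    by (subst absolutely_integrable_on_iff_nonneg) (auto intro: has_integral_integrable)
  then show si: "set_integrable lborel {0..1} (\<lambda>u. u powr a)"
    unfolding set_integrable_def by (subst (asm) integrable_completion) auto
  show "(LBINT u:{0..1}. u powr a) = 1 / (a + 1)"
    using set_borel_integral_eq_integral(2)[OF si] hi by (simp add: integral_unique)
qed

lemma set_integrable_continuous_times_powr:
  fixes \<phi> :: "real \<Rightarrow> real"
  assumes A: "A \<in> sets borel" "A \<subseteq> {0..1}"
    and a: "set_integrable lborel A (\<lambda>u. u powr a)"
    and \<phi>: "continuous_on UNIV \<phi>"
  shows "set_integrable lborel A (\<lambda>u. \<phi> u * u powr a)"
proof -
  have [measurable]: "\<phi> \<in> borel_measurable borel" using \<phi> by (rule borel_measurable_continuous_onI)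
  have [measurable]: "A \<in> sets borel" by (rule A)
  have "compact (\<phi> ` {0..1})"
    using \<phi> by (intro compact_continuous_image) (auto intro: continuous_on_subset)
  then have "bounded (\<phi> ` {0..1})" by (rule compact_imp_bounded)
  then obtain K where "\<forall>v\<in>\<phi> ` {0..1}. norm v \<le> K" unfolding bounded_iff by blast
  then have K: "norm (\<phi> u) \<le> K" if "u \<in> {0..1}" for u using that by blast
  have "set_integrable lborel A (\<lambda>u. K * u powr a)" using a by simp
  then show ?thesis
  proof (rule set_integrable_bound)
    show "set_borel_measurable lborel A (\<lambda>u. \<phi> u * u powr a)"
      unfolding set_borel_measurable_def by simp
    show "AE u in lborel. u \<in> A \<longrightarrow> norm (\<phi> u * u powr a) \<le> norm (K * u powr a)"
    proof (intro AE_I2 impI)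
      fix u assume "u \<in> A"
      then have "norm (\<phi> u) \<le> \<bar>K\<bar>" using K[of u] A(2) by fastforce
      then show "norm (\<phi> u * u powr a) \<le> norm (K * u powr a)"
        by (auto simp: abs_mult intro!: mult_right_mono)
    qed
  qed
qed

text \<open>A vanishing integral would force \<open>F\<close> to be 0 almost everywhere on
  \<open>A\<close>, making the interval from \<open>a\<close> to \<open>b\<close> a null
  set.\<close>

lemma LBINT_pos:
  fixes F :: "real \<Rightarrow> real"
  assumes si: "set_integrable lborel A F" and nn: "\<And>u. u \<in> A \<Longrightarrow> 0 \<le> F u"
    and ab: "a < b" "{a<..<b} \<subseteq> A" and pos: "\<And>u. a < u \<Longrightarrow> u < b \<Longrightarrow> 0 < F u"
  shows "0 < (LBINT u:A. F u)"
proof -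
  let ?f = "\<lambda>u. indicat_real A u *\<^sub>R F u"
  have nn': "0 \<le> ?f u" for u using nn by (auto simp: indicator_def)
  have "integral\<^sup>L lborel ?f \<noteq> 0"
  proof
    assume "integral\<^sup>L lborel ?f = 0"
    then have "AE u in lborel. ?f u = 0"
      using integral_nonneg_eq_0_iff_AE[of lborel ?f] si nn' by (simp add: set_integrable_def)
    then have "AE u in lborel. u \<notin> {a<..<b}"
    proof eventually_elim
      case (elim u)
      then show ?case using pos[of u] ab(2) by (auto simp: indicator_def split: if_splits)
    qed
    then have "emeasure lborel {a<..<b} = 0"
      by (subst (asm) AE_iff_measurable[where N="{a<..<b}"]) auto
    then show False using ab(1) by simp
  qed
  moreover have "0 \<le> integral\<^sup>L lborel ?f" using nn' by simp
  ultimately show ?thesis unfolding set_lebesgue_integral_def by simp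
qed

text \<open>Dominated convergence: the indicators of the inner intervals converge to that of
  \<open>{0..1}\<close> except at the endpoints 0 and 1.\<close>

lemma LBINT_inner_interval_tendsto:
  fixes F :: "real \<Rightarrow> real"
  assumes F: "set_integrable lborel {0..1} F"
  shows "((\<lambda>e. LBINT u:{e..1 - e}. F u) \<longlongrightarrow> (LBINT u:{0..1}. F u)) (at_right 0)"
proof (rule tendsto_at_right_sequentially[of 0 1])
  fix S :: "nat \<Rightarrow> real"
  assume S: "\<And>n. 0 < S n" "\<And>n. S n < 1" "S \<longlonglongrightarrow> 0"
  let ?g = "\<lambda>u. indicat_real {0..1} u *\<^sub>R F u"
  have g: "integrable lborel ?g" using F by (simp add: set_integrable_def)
  have eq: "indicat_real {S n..1 - S n} u *\<^sub>R F u = indicat_real {S n..1 - S n} u *\<^sub>R ?g u" for n u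
    using S(1)[of n] by (auto simp: indicator_def)
  show "(\<lambda>n. LBINT u:{S n..1 - S n}. F u) \<longlonglongrightarrow> (LBINT u:{0..1}. F u)"
    unfolding set_lebesgue_integral_def eq
  proof (rule integral_dominated_convergence[where w="\<lambda>u. norm (?g u)"])
    have "AE u in lborel. u \<noteq> (0::real)" "AE u in lborel. u \<noteq> (1::real)"
      by (auto intro: AE_lborel_singleton)
    then show "AE u in lborel. (\<lambda>n. indicat_real {S n..1 - S n} u *\<^sub>R ?g u) \<longlonglongrightarrow> ?g u"
    proof eventually_elim
      case (elim u)
      show ?case
      proof (cases "u \<in> {0..1}")
        case True
        with elim have u: "0 < u" "0 < 1 - u" by auto
        have "\<forall>\<^sub>F n in sequentially. S n < u" "\<forall>\<^sub>F n in sequentially. S n < 1 - u"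
          using order_tendstoD(2)[OF S(3)] u by auto
        then have "\<forall>\<^sub>F n in sequentially. indicat_real {S n..1 - S n} u *\<^sub>R ?g u = ?g u"
          by eventually_elim (auto simp: indicator_def)
        then show ?thesis by (rule tendsto_eventually)
      qed simp
    qed
  qed (use g in \<open>auto simp: indicator_def intro: borel_measurable_integrable\<close>)
qed simp

text \<open>The difference is u q(u) with q bounded on the unit interval. The factor u later cancels
  the singularity of u^(\<alpha>-1).\<close>

lemma poly_minus_const_bound:
  fixes p :: "real poly"
  obtains K where "K \<ge> 0" "\<And>u. 0 \<le> u \<Longrightarrow> u \<le> 1 \<Longrightarrow> \<bar>poly p u - poly p 0\<bar> \<le> K * u"
proof (cases p)
  case (pCons a q)
  have "compact (poly q ` {0..1})"
    by (intro compact_continuous_image continuous_intros) auto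
  then have "bounded (poly q ` {0..1})" by (rule compact_imp_bounded)
  then obtain K where "\<forall>v\<in>poly q ` {0..1}. norm v \<le> K" unfolding bounded_iff by blast
  then have K: "norm (poly q u) \<le> K" if "u \<in> {0..1}" for u using that by blast
  show ?thesis
  proof (rule that[of K])
    show "K \<ge> 0" using order_trans[OF norm_ge_zero K[of 0]] by simp
    show "\<bar>poly p u - poly p 0\<bar> \<le> K * u" if "0 \<le> u" "u \<le> 1" for u
      using mult_right_mono[OF K[of u] that(1)] that by (simp add: pCons abs_mult mult.commute)
  qed
qed

section \<open>Symmetry, positivity and size of B and D\<close>

text \<open>Exchanging busy and idle sources swaps \<nu> with \<mu> and \<open>x\<close> with
  \<open>N - x\<close>; facts about B are read off from those about D.\<close>

lemma engset_B_eq_D: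
  assumes "x \<le> N"
  shows "engset_B A N \<nu> \<mu> x \<alpha> = engset_D A N \<mu> \<nu> (N - x) \<alpha>"
  using assms by (simp add: engset_B_def engset_D_def)

text \<open>The exchange maps the levels C, C + 1 to N - C, N - C - 1, so the lower level of the
  pair becomes \<open>N - Suc C\<close>.\<close>

lemma engset_b_eq_d:
  assumes "C < N"
  shows "engset_b A N C \<nu> \<mu> \<alpha> = engset_d A N (N - Suc C) \<mu> \<nu> \<alpha>"
proof -
  have pw: "int N - int C - 1 = int (N - Suc C)" "int N - int (N - Suc C) - 1 = int C"
    using assms by auto
  show ?thesis by (simp only: engset_b_def engset_d_def pw power_int_of_nat)
qed

lemma engset_D_integrable:
  fixes A :: "real set"
  assumes "A \<in> sets borel" "A \<subseteq> {0..1}" "set_integrable lborel A (\<lambda>u. u powr (\<alpha> - 1))"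
  shows "set_integrable lborel A (\<lambda>u. (1 - u) ^ (N - x) * (1 + \<mu> / \<nu> * u) ^ x * u powr (\<alpha> - 1))"
  by (rule set_integrable_continuous_times_powr[OF assms]) (intro continuous_intros)

lemma engset_D_pos:
  fixes A :: "real set"
  assumes "\<mu> > 0" "\<nu> > 0" and A: "A \<in> sets borel" "A \<subseteq> {0..1}" "set_integrable lborel A (\<lambda>u. u powr (\<alpha> - 1))"
    and ab: "a < b" "{a<..<b} \<subseteq> A"
  shows "engset_D A N \<nu> \<mu> x \<alpha> > 0"
  unfolding engset_D_def
proof (rule LBINT_pos[OF engset_D_integrable[OF A] _ ab])
  \<comment> \<open>Only the open interval is known to lie in \<open>A\<close>; closures give the
    bounds on \<open>a\<close> and \<open>b\<close>.\<close>
  have sub: "{a..b} \<subseteq> {0..1}"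
    using closure_mono[OF order_trans[OF ab(2) A(2)]] ab(1) by (simp add: closure_greaterThanLessThan)
  then have "0 \<le> a" "b \<le> 1" using ab(1) by auto
  then show "0 < (1 - u) ^ (N - x) * (1 + \<mu> / \<nu> * u) ^ x * u powr (\<alpha> - 1)" if "a < u" "u < b" for u
    using that assms(1,2) by (auto intro!: mult_pos_pos zero_less_power add_pos_nonneg)
  show "0 \<le> (1 - u) ^ (N - x) * (1 + \<mu> / \<nu> * u) ^ x * u powr (\<alpha> - 1)" if "u \<in> A" for u
    using that assms(1,2) A(2) by (auto intro!: mult_nonneg_nonneg zero_le_power add_nonneg_nonneg)
qed

text \<open>The polynomial factor is 1 + O(u), and u u^(\<alpha>-1) = u^\<alpha> \<le> 1 absorbs the
  error. Since \<open>K\<close> depends neither on \<open>A\<close> nor on \<alpha>, it serves both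
  \<alpha> tending to 0 on \<open>{0..1}\<close> and e tending to 0 at \<alpha> = 0.\<close>

lemma engset_D_near_powr_integral:
  obtains K where "K \<ge> 0"
    "\<And>A \<alpha>. A \<in> sets borel \<Longrightarrow> A \<subseteq> {0..1} \<Longrightarrow> \<alpha> \<ge> 0 \<Longrightarrow> set_integrable lborel A (\<lambda>u. u powr (\<alpha> - 1)) \<Longrightarrow>
      \<bar>engset_D A N \<nu> \<mu> x \<alpha> - (LBINT u:A. u powr (\<alpha> - 1))\<bar> \<le> K"
proof -
  define \<phi> where "\<phi> u = (1 - u) ^ (N - x) * (1 + \<mu> / \<nu> * u) ^ x" for u
  define p where "p = [:1, -1:] ^ (N - x) * [:1, \<mu> / \<nu>:] ^ x"
  have \<phi>: "\<phi> u = poly p u" for u by (simp add: \<phi>_def p_def mult.commute)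
  have p0: "poly p 0 = 1" by (simp add: p_def)
  obtain K where K: "K \<ge> 0" "\<And>u. 0 \<le> u \<Longrightarrow> u \<le> 1 \<Longrightarrow> \<bar>poly p u - poly p 0\<bar> \<le> K * u"
    using poly_minus_const_bound by blast
  show ?thesis
  proof (rule that[OF K(1)])
    fix A :: "real set" and \<alpha> :: real
    assume A: "A \<in> sets borel" "A \<subseteq> {0..1}" and \<alpha>: "\<alpha> \<ge> 0"
      and si: "set_integrable lborel A (\<lambda>u. u powr (\<alpha> - 1))"
    have siK: "set_integrable lborel {0..1} (\<lambda>u::real. K)"
      by (intro borel_integrable_atLeastAtMost' continuous_intros)
    then have siKA: "set_integrable lborel A (\<lambda>u. K)"
      by (rule set_integrable_subset) (use A in auto)
    have siD: "set_integrable lborel A (\<lambda>u. \<phi> u * u powr (\<alpha> - 1))"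
      unfolding \<phi>_def by (rule engset_D_integrable[OF A si])
    have "engset_D A N \<nu> \<mu> x \<alpha> - (LBINT u:A. u powr (\<alpha> - 1)) =
        (LBINT u:A. \<phi> u * u powr (\<alpha> - 1) - u powr (\<alpha> - 1))"
      unfolding engset_D_def \<phi>_def[symmetric] using siD si by simp
    also have "\<bar>\<dots>\<bar> \<le> (LBINT u:A. \<bar>\<phi> u * u powr (\<alpha> - 1) - u powr (\<alpha> - 1)\<bar>)"
      using set_integral_norm_bound[OF set_integral_diff(1)[OF siD si]] by simp
    also have "\<dots> \<le> (LBINT u:A. K)"
    proof (rule set_integral_mono[OF _ siKA])
      show "set_integrable lborel A (\<lambda>u. \<bar>\<phi> u * u powr (\<alpha> - 1) - u powr (\<alpha> - 1)\<bar>)"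
        using set_integrable_abs[OF set_integral_diff(1)[OF siD si]] .
      fix u assume "u \<in> A"
      then have u: "0 \<le> u" "u \<le> 1" using A(2) by auto
      have "\<phi> u * u powr (\<alpha> - 1) - u powr (\<alpha> - 1) = (poly p u - poly p 0) * u powr (\<alpha> - 1)"
        by (simp add: \<phi> p0 algebra_simps)
      also have "\<bar>\<dots>\<bar> \<le> K * u * u powr (\<alpha> - 1)"
        using K(2)[OF u] by (auto simp: abs_mult intro!: mult_right_mono)
      also have "\<dots> = K * u powr \<alpha>"
        using u by (cases "u = 0") (simp_all add: powr_mult_base)
      also have "\<dots> \<le> K * 1"
        using K(1) u \<alpha> by (intro mult_left_mono powr_le1) auto
      finally show "\<bar>\<phi> u * u powr (\<alpha> - 1) - u powr (\<alpha> - 1)\<bar> \<le> K" by simp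
    qed
    also have "\<dots> \<le> (LBINT u:{0..1::real}. K)"
    proof -
      have "integrable lborel (\<lambda>u. indicat_real A u *\<^sub>R K)" "integrable lborel (\<lambda>u. indicat_real {0..1::real} u *\<^sub>R K)"
        using siK siKA by (simp_all only: set_integrable_def)
      then show ?thesis
        unfolding set_lebesgue_integral_def
        by (rule Bochner_Integration.integral_mono) (use K(1) A(2) in \<open>auto simp: indicator_def\<close>)
    qed
    also have "\<dots> = K" by (simp add: set_lebesgue_integral_def)
    finally show "\<bar>engset_D A N \<nu> \<mu> x \<alpha> - (LBINT u:A. u powr (\<alpha> - 1))\<bar> \<le> K" .
  qed
qed

section \<open>Increments of D and the harmonic equation\<close>

text \<open>After extracting the common powers, (1 + r u) - (1 - u) = (1 + r) u remains, where r =
  \<mu> / \<nu> and \<nu> (1 + r) = 1. The factor u raises the exponent \<alpha> - 1 to \<alpha>.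
  The level is arbitrary, because the harmonic equation uses the increments at all levels.\<close>

lemma engset_D_Suc_diff:
  assumes "\<nu> > 0" "\<mu> + \<nu> = 1" and x: "x < N" and \<alpha>: "\<alpha> > 0"
  shows "engset_d {0..1} N x \<nu> \<mu> \<alpha> =
    \<mu> * \<nu> * (engset_D {0..1} N \<nu> \<mu> (Suc x) \<alpha> - engset_D {0..1} N \<nu> \<mu> x \<alpha>)"
proof -
  define r where "r = \<mu> / \<nu>"
  have r: "\<nu> * (1 + r) = 1" using assms(1,2) by (simp add: r_def field_simps)
  have pw: "int N - int x - 1 = int (N - Suc x)" using x by simp
  have si: "set_integrable lborel {0..1} (\<lambda>u::real. u powr (\<alpha> - 1))"
    using \<alpha> by (intro LBINT_powr_0_1) simp
  note siD = engset_D_integrable[OF _ _ si, of N]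
  have diff: "engset_D {0..1} N \<nu> \<mu> (Suc x) \<alpha> - engset_D {0..1} N \<nu> \<mu> x \<alpha> =
    (LBINT u:{0..1}. (1 - u) ^ (N - Suc x) * (1 + \<mu> / \<nu> * u) ^ Suc x * u powr (\<alpha> - 1) -
       (1 - u) ^ (N - x) * (1 + \<mu> / \<nu> * u) ^ x * u powr (\<alpha> - 1))"
    unfolding engset_D_def
    by (rule set_integral_diff(2)[symmetric]) (intro siD; simp)+
  have "\<nu> * (engset_D {0..1} N \<nu> \<mu> (Suc x) \<alpha> - engset_D {0..1} N \<nu> \<mu> x \<alpha>) = (LBINT u:{0..1}. (1 - u) ^ (N - Suc x) * (1 + \<mu> / \<nu> * u) ^ x * u powr \<alpha>)"
    unfolding diff set_integral_mult_right[symmetric]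
  proof (rule set_lebesgue_integral_cong)
    show "\<forall>u. u \<in> {0..1} \<longrightarrow> \<nu> * ((1 - u) ^ (N - Suc x) * (1 + \<mu> / \<nu> * u) ^ Suc x * u powr (\<alpha> - 1) -
       (1 - u) ^ (N - x) * (1 + \<mu> / \<nu> * u) ^ x * u powr (\<alpha> - 1)) =
       (1 - u) ^ (N - Suc x) * (1 + \<mu> / \<nu> * u) ^ x * u powr \<alpha>"
    proof (intro allI impI)
      fix u :: real assume "u \<in> {0..1}"
      then have pow: "u powr \<alpha> = u * u powr (\<alpha> - 1)" by (cases "u = 0") (simp_all add: powr_mult_base)
      have N: "N - x = Suc (N - Suc x)" using x by simp
      have eq: "\<nu> * ((1 - u) ^ (N - Suc x) * (1 + r * u) ^ Suc x * u powr (\<alpha> - 1) -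
         (1 - u) ^ (N - x) * (1 + r * u) ^ x * u powr (\<alpha> - 1)) =
         (\<nu> * (1 + r)) * ((1 - u) ^ (N - Suc x) * (1 + r * u) ^ x * (u * u powr (\<alpha> - 1)))"
      proof -
        have "\<nu> * (P * ((1 + r * u) * Q) * w - ((1 - u) * P) * Q * w) = (\<nu> * (1 + r)) * (P * Q * (u * w))"
          for P Q w by (simp add: algebra_simps)
        then show ?thesis unfolding N power_Suc .
      qed
      show "\<nu> * ((1 - u) ^ (N - Suc x) * (1 + \<mu> / \<nu> * u) ^ Suc x * u powr (\<alpha> - 1) -
         (1 - u) ^ (N - x) * (1 + \<mu> / \<nu> * u) ^ x * u powr (\<alpha> - 1)) =
         (1 - u) ^ (N - Suc x) * (1 + \<mu> / \<nu> * u) ^ x * u powr \<alpha>"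
        unfolding pow using eq[unfolded r mult_1_left, unfolded r_def] by (simp only: mult.assoc)
    qed
  qed simp
  then show ?thesis unfolding engset_d_def pw power_int_of_nat by (simp only: mult.assoc)
qed

text \<open>The function \<open>W\<close> vanishes at 0 because \<alpha> > 0 and at 1 because x < N,
  so its derivative integrates to 0. The derivatives of its first two factors yield increments of D,
  that of the third yields \<alpha> D.\<close>

lemma engset_D_harmonic:
  assumes "\<nu> > 0" "\<mu> > 0" "\<mu> + \<nu> = 1" and x: "x < N" and \<alpha>: "\<alpha> > 0"
  defines "D \<equiv> \<lambda>x. engset_D {0..1} N \<nu> \<mu> x \<alpha>"
  shows "\<mu> * real x * (D (x - 1) - D x) + \<nu> * (real N - real x) * (D (Suc x) - D x) = \<alpha> * D x"
proof -
  define r where "r = \<mu> / \<nu>"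
  have [simp]: "\<nu> \<noteq> 0" "\<mu> \<noteq> 0" using assms by auto
  define E where "E x = (\<lambda>u::real. (1 - u) ^ (N - Suc x) * (1 + r * u) ^ x * u powr \<alpha>)" for x
  define W where "W = (\<lambda>u::real. (1 - u) ^ (N - x) * (1 + r * u) ^ x * u powr \<alpha>)"
  define F where "F = (\<lambda>u::real. (1 - u) ^ (N - x) * (1 + r * u) ^ x * u powr (\<alpha> - 1))"
  have siE: "set_integrable lborel {0..1} (E y)" for y
    unfolding E_def using \<alpha>
    by (intro set_integrable_continuous_times_powr LBINT_powr_0_1 continuous_intros) auto
  have siF: "set_integrable lborel {0..1} F"
    unfolding F_def using \<alpha>
    by (intro set_integrable_continuous_times_powr LBINT_powr_0_1 continuous_intros) auto
  have ED: "(LBINT u:{0..1}. E y u) = \<nu> * (D (Suc y) - D y)" if "y < N" for y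
  proof -
    have pw: "int N - int y - 1 = int (N - Suc y)" using that by simp
    show ?thesis
      using engset_D_Suc_diff[OF assms(1,3) that \<alpha>] unfolding engset_d_def pw power_int_of_nat
      by (simp add: E_def D_def r_def)
  qed
  define w where "w u = real x * r * E (x - 1) u - real (N - x) * E x u + \<alpha> * F u" for u
  have "(w has_integral (W 1 - W 0)) {0..1}"
  proof (rule fundamental_theorem_of_calculus_interior)
    show "continuous_on {0..1} W"
      unfolding W_def using \<alpha> by (intro continuous_intros continuous_on_powr') auto
    fix u :: real assume u: "u \<in> {0<..<1}"
    have d1: "((\<lambda>u. (1 - u) ^ (N - x)) has_real_derivative - (real (N - x) * (1 - u) ^ (N - Suc x))) (at u)"
      by (auto intro!: derivative_eq_intros)
    have d2: "((\<lambda>u. (1 + r * u) ^ x) has_real_derivative real x * r * (1 + r * u) ^ (x - 1)) (at u)"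
      by (auto intro!: derivative_eq_intros)
    have d3: "((\<lambda>u. u powr \<alpha>) has_real_derivative \<alpha> * u powr (\<alpha> - 1)) (at u)"
      using u by (intro has_real_derivative_powr) auto
    \<comment> \<open>At \<open>x = 0\<close> the truncated \<open>x - 1\<close> is multiplied by
      0.\<close>
    have E: "real x * r * E (x - 1) u = real x * r * ((1 - u) ^ (N - x) * (1 + r * u) ^ (x - 1) * u powr \<alpha>)"
      by (cases x) (simp_all add: E_def)
    have "(W has_real_derivative w u) (at u)"
      unfolding W_def
      by (rule DERIV_cong[OF DERIV_mult[OF DERIV_mult[OF d1 d2] d3]])
        (unfold w_def E, unfold E_def F_def, simp add: algebra_simps)
    then show "(W has_vector_derivative w u) (at u)"
      by (simp add: has_real_derivative_iff_has_vector_derivative)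
  qed simp
  moreover have "W 1 = 0" "W 0 = 0" using x \<alpha> by (auto simp: W_def)
  ultimately have "integral {0..1} w = 0" by (simp add: integral_unique)
  moreover have siw: "set_integrable lborel {0..1} w"
    unfolding w_def using siE siF by (intro set_integral_add set_integral_diff set_integrable_mult_right) auto
  ultimately have "0 = (LBINT u:{0..1}. w u)"
    by (simp add: set_borel_integral_eq_integral(2))
  also have "\<dots> = real x * r * (LBINT u:{0..1}. E (x - 1) u) - real (N - x) * (LBINT u:{0..1}. E x u) +
      \<alpha> * (LBINT u:{0..1}. F u)"
    unfolding w_def using siE siF by (simp add: set_integral_add set_integral_diff)
  also have "(LBINT u:{0..1}. F u) = D x" by (simp add: F_def D_def engset_D_def r_def)
  also have "(LBINT u:{0..1}. E x u) = \<nu> * (D (Suc x) - D x)" by (rule ED[OF x])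
  also have "real x * r * (LBINT u:{0..1}. E (x - 1) u) = \<mu> * real x * (D x - D (x - 1))"
  proof (cases "x = 0")
    case False
    then show ?thesis using ED[of "x - 1"] x by (simp add: r_def)
  qed simp
  finally show ?thesis using x by (simp add: of_nat_diff algebra_simps)
qed

section \<open>First passage of the Engset process for \<alpha> > 0\<close>

lemma engset_generator_sum:
  assumes "s \<le> C"
  shows "(\<Sum>s'\<in>{0..C} - {s}. engset_rate N C \<nu> \<mu> s s' * (f s' - f s)) =
    \<mu> * real s * (f (s - 1) - f s) + (if s < C then \<nu> * (real N - real s) * (f (Suc s) - f s) else 0)"
proof -
  have down: "(\<Sum>s'\<in>{0..C}. if s = Suc s' then \<mu> * real s * (f s' - f s) else 0) =
      \<mu> * real s * (f (s - 1) - f s)"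
  proof (cases s)
    case (Suc k)
    then show ?thesis using assms by simp
  qed simp
  have "(\<Sum>s'\<in>{0..C} - {s}. engset_rate N C \<nu> \<mu> s s' * (f s' - f s)) =
      (\<Sum>s'\<in>{0..C}. engset_rate N C \<nu> \<mu> s s' * (f s' - f s))"
    by (rule sum.mono_neutral_left) auto
  also have "\<dots> = (\<Sum>s'\<in>{0..C}. (if s = Suc s' then \<mu> * real s * (f s' - f s) else 0) +
      (if s' = Suc s then if s < C then \<nu> * (real N - real s) * (f s' - f s) else 0 else 0))"
    by (intro sum.cong refl) (auto simp: engset_rate_def)
  also have "\<dots> = \<mu> * real s * (f (s - 1) - f s) + (if s < C then \<nu> * (real N - real s) * (f (Suc s) - f s) else 0)"
    unfolding sum.distrib down by simp
  finally show ?thesis .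
qed

text \<open>Jumps lead to neighbours, so the equations below \<open>y\<close> involve
  \<open>g\<close> alone and those above \<open>y\<close> involve \<open>h\<close> alone. Both are
  scaled to 1 at \<open>y\<close> and glued there, which covers starting points on either
  side.\<close>

lemma engset_hitting_laplace:
  fixes g h :: "nat \<Rightarrow> real"
  assumes X: "engset_process M N C \<nu> \<mu> z X" and y: "y \<le> C" and z: "z \<le> C" and \<alpha>: "\<alpha> > 0"
    and g: "\<And>s. s < y \<Longrightarrow> \<mu> * real s * (g (s - 1) - g s) + \<nu> * (real N - real s) * (g (Suc s) - g s) = \<alpha> * g s"
    and h: "\<And>s. y < s \<Longrightarrow> s \<le> C \<Longrightarrow> \<mu> * real s * (h (s - 1) - h s) +
      (if s < C then \<nu> * (real N - real s) * (h (Suc s) - h s) else 0) = \<alpha> * h s"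
    and ne: "g y \<noteq> 0" "h y \<noteq> 0"
  shows "hitting_laplace M X y \<alpha> = (if z \<le> y then g z / g y else h z / h y)"
proof -
  define f where "f s = (if s \<le> y then g s / g y else h s / h y)" for s
  have f_up: "f s = g s / g y" if "s \<le> y" for s using that by (simp add: f_def)
  have f_down: "f s = h s / h y" if "y \<le> s" for s using that ne by (auto simp: f_def)
  have "hitting_laplace M X y \<alpha> = f z"
  proof (rule hitting_laplace_eqI[OF X[unfolded engset_process_def]])
    fix s assume s: "s \<in> {0..C} - {y}"
    show "(\<Sum>s'\<in>{0..C} - {s}. engset_rate N C \<nu> \<mu> s s' * (f s' - f s)) = \<alpha> * f s"
    proof (cases "s < y")
      case True
      then have "(\<Sum>s'\<in>{0..C} - {s}. engset_rate N C \<nu> \<mu> s s' * (f s' - f s)) =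
         (\<mu> * real s * (g (s - 1) - g s) + \<nu> * (real N - real s) * (g (Suc s) - g s)) / g y"
        using s y by (subst engset_generator_sum) (auto simp: f_up diff_divide_distrib[symmetric] add_divide_distrib)
      then show ?thesis unfolding g[OF True] using True by (simp add: f_up)
    next
      case False
      then have sy: "y < s" "s \<le> C" using s by auto
      then have "(\<Sum>s'\<in>{0..C} - {s}. engset_rate N C \<nu> \<mu> s s' * (f s' - f s)) =
         (\<mu> * real s * (h (s - 1) - h s) + (if s < C then \<nu> * (real N - real s) * (h (Suc s) - h s) else 0)) / h y"
        by (subst engset_generator_sum) (auto simp: f_down diff_divide_distrib[symmetric] add_divide_distrib)
      then show ?thesis unfolding h[OF sy] using sy by (simp add: f_down)
    qed
  qed (use y z \<alpha> ne in \<open>auto simp: f_def\<close>)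
  then show ?thesis by (simp add: f_def)
qed

text \<open>This is the equation for D at the mirrored level \<open>N - x\<close>, whose condition N
  - x < N reads 0 < x.\<close>

lemma engset_B_harmonic:
  assumes "\<nu> > 0" "\<mu> > 0" "\<mu> + \<nu> = 1" and x: "0 < x" "x \<le> N" and \<alpha>: "\<alpha> > 0"
  defines "B \<equiv> \<lambda>x. engset_B {0..1} N \<nu> \<mu> x \<alpha>"
  shows "\<mu> * real x * (B (x - 1) - B x) + \<nu> * (real N - real x) * (B (Suc x) - B x) = \<alpha> * B x"
proof -
  let ?D = "\<lambda>x. engset_D {0..1} N \<mu> \<nu> x \<alpha>"
  have B: "B x = ?D (N - x)" "B (x - 1) = ?D (Suc (N - x))"
    using x by (auto simp: B_def engset_B_eq_D Suc_diff_le)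
  \<comment> \<open>At \<open>x = N\<close> the level \<open>Suc x\<close> lies outside the range of
    the exchange, but its coefficient is 0.\<close>
  have B': "(real N - real x) * (B (Suc x) - B x) = (real N - real x) * (?D (N - x - 1) - ?D (N - x))"
    using x by (cases "x = N") (auto simp: B_def engset_B_eq_D)
  have "\<nu> * real (N - x) * (?D (N - x - 1) - ?D (N - x)) +
      \<mu> * (real N - real (N - x)) * (?D (Suc (N - x)) - ?D (N - x)) = \<alpha> * ?D (N - x)"
    using assms by (intro engset_D_harmonic) auto
  then show ?thesis using x unfolding mult.assoc B' unfolding B by (simp add: of_nat_diff mult.assoc)
qed

lemma engset_b_B_diff:
  assumes "\<mu> > 0" "\<mu> + \<nu> = 1" and C: "C < N" and \<alpha>: "\<alpha> > 0"
  shows "engset_b {0..1} N C \<nu> \<mu> \<alpha> =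
    \<mu> * \<nu> * (engset_B {0..1} N \<nu> \<mu> C \<alpha> - engset_B {0..1} N \<nu> \<mu> (Suc C) \<alpha>)"
  using engset_D_Suc_diff[of \<mu> \<nu> "N - Suc C" N \<alpha>] assms
  by (simp add: engset_b_eq_d engset_B_eq_D Suc_diff_Suc mult.commute add.commute)

text \<open>By linearity \<open>h\<close> solves the equation with the uncapped upward rate at every
  level from 1 to \<open>C\<close>. The coefficients are chosen so that the products of increments
  of B and D cancel in \<open>h (Suc C) - h C\<close>; hence dropping the jump from \<open>C\<close>
  changes nothing.\<close>

lemma engset_down_harmonic:
  assumes "\<nu> > 0" "\<mu> > 0" "\<mu> + \<nu> = 1" and C: "C < N" and x: "0 < x" "x \<le> C" and \<alpha>: "\<alpha> > 0"
  defines "h \<equiv> \<lambda>x. engset_d {0..1} N C \<nu> \<mu> \<alpha> * engset_B {0..1} N \<nu> \<mu> x \<alpha> +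
    engset_b {0..1} N C \<nu> \<mu> \<alpha> * engset_D {0..1} N \<nu> \<mu> x \<alpha>"
  shows "\<mu> * real x * (h (x - 1) - h x) + (if x < C then \<nu> * (real N - real x) * (h (Suc x) - h x) else 0) = \<alpha> * h x"
proof -
  define B where "B x = engset_B {0..1} N \<nu> \<mu> x \<alpha>" for x
  define D where "D x = engset_D {0..1} N \<nu> \<mu> x \<alpha>" for x
  define b where "b = engset_b {0..1} N C \<nu> \<mu> \<alpha>"
  define d where "d = engset_d {0..1} N C \<nu> \<mu> \<alpha>"
  have b: "b = \<mu> * \<nu> * (B C - B (Suc C))"
    unfolding b_def B_def using assms by (intro engset_b_B_diff)
  have d: "d = \<mu> * \<nu> * (D (Suc C) - D C)"
    unfolding d_def D_def using assms by (intro engset_D_Suc_diff)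
  have h: "h = (\<lambda>x. d * B x + b * D x)"
    by (simp add: h_def B_def D_def b_def d_def)
  have top: "h (Suc C) - h C = 0" unfolding h b d by (simp add: algebra_simps)
  have "\<mu> * real x * (B (x - 1) - B x) + \<nu> * (real N - real x) * (B (Suc x) - B x) = \<alpha> * B x"
    "\<mu> * real x * (D (x - 1) - D x) + \<nu> * (real N - real x) * (D (Suc x) - D x) = \<alpha> * D x"
    unfolding B_def D_def
    using engset_B_harmonic[of \<nu> \<mu> x N \<alpha>] engset_D_harmonic[of \<nu> \<mu> x N \<alpha>] assms by simp_all
  then have "d * (\<mu> * real x * (B (x - 1) - B x) + \<nu> * (real N - real x) * (B (Suc x) - B x)) +
     b * (\<mu> * real x * (D (x - 1) - D x) + \<nu> * (real N - real x) * (D (Suc x) - D x)) = d * (\<alpha> * B x) + b * (\<alpha> * D x)"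
    by simp
  then have full: "\<mu> * real x * (h (x - 1) - h x) + \<nu> * (real N - real x) * (h (Suc x) - h x) = \<alpha> * h x"
    unfolding h by (simp add: algebra_simps)
  show ?thesis
  proof (cases "x < C")
    case False
    then have "x = C" using x by simp
    then show ?thesis using full top by simp
  qed (use full in simp)
qed

section \<open>Limits over the inner intervals\<close>

text \<open>The weight \<open>w\<close> cancels and leaves an error of order K / (L - K). It may
  itself diverge, as d + b does for C = N on shrinking e.\<close>

lemma quotient_tendsto_1:
  fixes num den w L :: "'a \<Rightarrow> real"
  assumes L: "filterlim L at_top F"
    and ev: "\<forall>\<^sub>F e in F. 0 < w e \<and> \<bar>num e - w e * L e\<bar> \<le> w e * K \<and> \<bar>den e - w e * L e\<bar> \<le> w e * K"
  shows "((\<lambda>e. num e / den e) \<longlongrightarrow> 1) F"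
proof -
  have "((\<lambda>e. 2 * K / (L e - K)) \<longlongrightarrow> 0) F"
    by (rule tendsto_divide_0[OF tendsto_const filterlim_at_top_imp_at_infinity])
      (use filterlim_tendsto_add_at_top[OF tendsto_const[of "- K"] L] in simp)
  then have "((\<lambda>e. num e / den e - 1) \<longlongrightarrow> 0) F"
  proof (rule Lim_null_comparison[rotated])
    have "\<forall>\<^sub>F e in F. L e > K" using L by (auto simp: filterlim_at_top_dense)
    with ev show "\<forall>\<^sub>F e in F. norm (num e / den e - 1) \<le> 2 * K / (L e - K)"
    proof eventually_elim
      case (elim e)
      have w: "0 < w e" by (use elim in blast)
      have den: "w e * (L e - K) \<le> den e" using elim by (simp add: algebra_simps abs_le_iff)
      moreover have pos: "0 < w e * (L e - K)" using elim by simp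
      ultimately have den0: "0 < den e" by linarith
      have diff: "\<bar>num e - den e\<bar> \<le> 2 * (w e * K)" using elim by linarith
      have "norm (num e / den e - 1) = \<bar>num e - den e\<bar> / den e"
        using den0 by (simp add: field_simps)
      also have "\<dots> \<le> 2 * (w e * K) / (w e * (L e - K))"
        using diff den pos by (intro frac_le) auto
      also have "\<dots> = 2 * K / (L e - K)" using w by simp
      finally show ?case .
    qed
  qed
  then show ?thesis by (simp add: LIM_zero_iff)
qed

lemma powr_integrable_inner:
  fixes e :: real
  assumes "0 < e"
  shows "set_integrable lborel {e..1 - e} (\<lambda>u. u powr a)"
  using assms by (intro borel_integrable_atLeastAtMost' continuous_intros) auto

lemma LBINT_inverse_at_top:
  "filterlim (\<lambda>e::real. LBINT u:{e..1 - e}. u powr (0 - 1)) at_top (at_right 0)"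
proof -
  have "\<forall>\<^sub>F e in at_right (0::real). e \<in> {0<..<1 / 2}"
    by (rule eventually_at_right_real) simp
  then have cong: "\<forall>\<^sub>F e in at_right (0::real). ln (1 - e) - ln e = (LBINT u:{e..1 - e}. u powr (0 - 1))"
  proof eventually_elim
    case (elim e)
    have "((\<lambda>u. u powr (0 - 1)) has_integral (ln (1 - e) - ln e)) {e..1 - e}"
    proof (rule fundamental_theorem_of_calculus)
      fix u assume "u \<in> {e..1 - e}"
      then have u: "0 < u" using elim by auto
      then have eq: "u powr (0 - 1) = 1 / u" by (simp add: powr_minus_divide)
      have "(ln has_real_derivative u powr (0 - 1)) (at u within {e..1 - e})"
        unfolding eq using u by (auto intro!: derivative_eq_intros)
      then show "(ln has_vector_derivative u powr (0 - 1)) (at u within {e..1 - e})"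
        by (simp add: has_real_derivative_iff_has_vector_derivative)
    qed (use elim in auto)
    then show ?case
      using set_borel_integral_eq_integral(2)[OF powr_integrable_inner[of e "0 - 1"]] elim
      by (simp add: integral_unique)
  qed
  have "filterlim (\<lambda>e::real. ln (1 - e) - ln e) at_top (at_right 0)" by real_asymp
  then show ?thesis using filterlim_cong[OF refl refl cong] by simp
qed

lemma engset_D_tendsto:
  assumes "\<alpha> > 0"
  shows "((\<lambda>e. engset_D {e..1 - e} N \<nu> \<mu> x \<alpha>) \<longlongrightarrow> engset_D {0..1} N \<nu> \<mu> x \<alpha>) (at_right 0)"
  unfolding engset_D_def using assms
  by (intro LBINT_inner_interval_tendsto engset_D_integrable LBINT_powr_0_1) auto

lemma engset_d_integrand_integrable:
  assumes "C < N" "\<alpha> \<ge> 0"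
  shows "set_integrable lborel {0..1::real} (\<lambda>u. (1 - u) powi (int N - int C - 1) * (1 + \<mu> / \<nu> * u) ^ C * u powr \<alpha>)"
proof -
  have pw: "int N - int C - 1 = int (N - Suc C)" using assms by simp
  show ?thesis
    unfolding pw power_int_of_nat using assms
    by (intro set_integrable_continuous_times_powr LBINT_powr_0_1 continuous_intros) auto
qed

lemma engset_d_tendsto:
  assumes "C < N" "\<alpha> \<ge> 0"
  shows "((\<lambda>e. engset_d {e..1 - e} N C \<nu> \<mu> \<alpha>) \<longlongrightarrow> engset_d {0..1} N C \<nu> \<mu> \<alpha>) (at_right 0)"
  unfolding engset_d_def using assms
  by (intro tendsto_mult tendsto_const LBINT_inner_interval_tendsto engset_d_integrand_integrable)

text \<open>On the inner interval 1 - u stays away from 0, so the exponent -1 of the case C = N is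
  covered.\<close>

lemma engset_d_integrand_integrable_inner:
  fixes e :: real
  assumes "0 < e"
  shows "set_integrable lborel {e..1 - e} (\<lambda>u. (1 - u) powi (int N - int C - 1) * (1 + \<mu> / \<nu> * u) ^ C * u powr \<alpha>)"
  using assms by (intro borel_integrable_atLeastAtMost' continuous_intros) auto

lemma engset_b_integrand_integrable_inner:
  fixes e :: real
  assumes "0 < e" "\<mu> > 0" "\<nu> > 0"
  shows "set_integrable lborel {e..1 - e} (\<lambda>u. (1 - u) ^ C * (1 + \<nu> / \<mu> * u) powi (int N - int C - 1) * u powr \<alpha>)"
proof -
  have "1 + \<nu> / \<mu> * u \<noteq> 0" if "u \<in> {e..1 - e}" for u
  proof -
    have "0 \<le> \<nu> / \<mu> * u" using that assms by auto
    then show ?thesis by linarith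
  qed
  then show ?thesis
    using assms by (intro borel_integrable_atLeastAtMost' continuous_intros) auto
qed

lemma engset_d_pos:
  fixes a b :: real
  assumes "\<mu> > 0" "\<nu> > 0" "0 \<le> a" "a < b" "b \<le> 1"
    and "set_integrable lborel {a..b} (\<lambda>u. (1 - u) powi (int N - int C - 1) * (1 + \<mu> / \<nu> * u) ^ C * u powr \<alpha>)"
  shows "engset_d {a..b} N C \<nu> \<mu> \<alpha> > 0"
  unfolding engset_d_def using assms
  by (intro mult_pos_pos LBINT_pos[of _ _ a b])
    (auto intro!: mult_pos_pos mult_nonneg_nonneg zero_le_power_int zero_less_power_int
      zero_less_power zero_le_power add_pos_nonneg add_nonneg_nonneg)

lemma engset_b_pos:
  fixes a b :: real
  assumes "\<mu> > 0" "\<nu> > 0" "0 \<le> a" "a < b" "b \<le> 1"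
    and "set_integrable lborel {a..b} (\<lambda>u. (1 - u) ^ C * (1 + \<nu> / \<mu> * u) powi (int N - int C - 1) * u powr \<alpha>)"
  shows "engset_b {a..b} N C \<nu> \<mu> \<alpha> > 0"
  unfolding engset_b_def using assms
  by (intro mult_pos_pos LBINT_pos[of _ _ a b])
    (auto intro!: mult_pos_pos mult_nonneg_nonneg zero_le_power_int zero_less_power_int
      zero_less_power zero_le_power add_pos_nonneg add_nonneg_nonneg)

text \<open>The factor with exponent -1 has base at least 1, so the integrand is at most 1. Together
  with the divergence of d this gives b / d tending to 0.\<close>

lemma engset_b_le:
  fixes e :: real
  assumes "\<mu> > 0" "\<nu> > 0" "0 < e" "e < 1 / 2" "\<alpha> \<ge> 0"
  shows "engset_b {e..1 - e} N N \<nu> \<mu> \<alpha> \<le> \<nu>"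
proof -
  have "(LBINT u:{e..1 - e}. (1 - u) ^ N * (1 + \<nu> / \<mu> * u) powi (int N - int N - 1) * u powr \<alpha>) \<le>
      (LBINT u:{e..1 - e}. 1)"
  proof (rule set_integral_mono[OF engset_b_integrand_integrable_inner[OF assms(3,1,2)]])
    show "set_integrable lborel {e..1 - e} (\<lambda>u. 1::real)"
      by (intro borel_integrable_atLeastAtMost' continuous_intros)
    fix u assume "u \<in> {e..1 - e}"
    then have u: "0 \<le> u" "u \<le> 1" using assms(3) by auto
    have "1 \<le> 1 + \<nu> / \<mu> * u" using u assms by simp
    then have "inverse (1 + \<nu> / \<mu> * u) \<le> 1" "0 \<le> inverse (1 + \<nu> / \<mu> * u)"
      by (simp_all add: inverse_le_1_iff)
    moreover have "(1 - u) ^ N \<le> 1" using u by (simp add: power_le_one)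
    moreover have "u powr \<alpha> \<le> 1" using u assms by (simp add: powr_le1)
    ultimately show "(1 - u) ^ N * (1 + \<nu> / \<mu> * u) powi (int N - int N - 1) * u powr \<alpha> \<le> 1"
      using u by (simp add: mult_le_one)
  qed
  also have "\<dots> \<le> 1"
    using assms(3,4) by (simp add: set_lebesgue_integral_def)
  finally show ?thesis unfolding engset_b_def using assms(2) by simp
qed

lemma engset_d_full_at_top:
  assumes "\<mu> > 0" "\<nu> > 0" "\<alpha> \<ge> 0"
  shows "filterlim (\<lambda>e. engset_d {e..1 - e} N N \<nu> \<mu> \<alpha>) at_top (at_right 0)"
proof (rule filterlim_at_top_mono)
  define c where "c = \<mu> * (1 / 2) powr \<alpha>"
  have c: "c > 0" using assms by (simp add: c_def)
  show "filterlim (\<lambda>e. c * (ln (1 - e) - ln e - 2 * (1 - 2 * e))) at_top (at_right 0)"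
    using c by real_asymp
  have "\<forall>\<^sub>F e in at_right (0::real). e \<in> {0<..<1 / 2}"
    by (rule eventually_at_right_real) simp
  then show "\<forall>\<^sub>F e in at_right 0. c * (ln (1 - e) - ln e - 2 * (1 - 2 * e)) \<le> engset_d {e..1 - e} N N \<nu> \<mu> \<alpha>"
  proof eventually_elim
    case (elim e)
    \<comment> \<open>The subtracted 2 is the value of 1 / (1 - u) at u = 1/2. It makes the minorant
      nonpositive on the left half, while on the right half u^\<alpha> is at least (1/2)^\<alpha>;
      the integral need not be split.\<close>
    let ?g = "\<lambda>u::real. (1 / 2) powr \<alpha> * (1 / (1 - u) - 2)"
    have si: "set_integrable lborel {e..1 - e} ?g"
      using elim by (intro borel_integrable_atLeastAtMost' continuous_intros) auto
    have "(?g has_integral ((1 / 2) powr \<alpha> * (- ln (1 - (1 - e)) - 2 * (1 - e)) -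
        (1 / 2) powr \<alpha> * (- ln (1 - e) - 2 * e))) {e..1 - e}"
    proof (rule fundamental_theorem_of_calculus)
      fix u assume "u \<in> {e..1 - e}"
      then have "((\<lambda>u. (1 / 2) powr \<alpha> * (- ln (1 - u) - 2 * u)) has_real_derivative ?g u) (at u within {e..1 - e})"
        using elim by (auto intro!: derivative_eq_intros)
      then show "((\<lambda>u. (1 / 2) powr \<alpha> * (- ln (1 - u) - 2 * u)) has_vector_derivative ?g u) (at u within {e..1 - e})"
        by (simp add: has_real_derivative_iff_has_vector_derivative)
    qed (use elim in auto)
    then have I: "(LBINT u:{e..1 - e}. ?g u) = (1 / 2) powr \<alpha> * (- ln (1 - (1 - e)) - 2 * (1 - e)) -
        (1 / 2) powr \<alpha> * (- ln (1 - e) - 2 * e)"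
      unfolding set_borel_integral_eq_integral(2)[OF si] by (rule integral_unique)
    have "c * (ln (1 - e) - ln e - 2 * (1 - 2 * e)) = \<mu> * (LBINT u:{e..1 - e}. ?g u)"
      unfolding I c_def by (simp add: algebra_simps)
    also have "(LBINT u:{e..1 - e}. ?g u) \<le>
        (LBINT u:{e..1 - e}. (1 - u) powi (int N - int N - 1) * (1 + \<mu> / \<nu> * u) ^ N * u powr \<alpha>)"
    proof (rule set_integral_mono[OF si engset_d_integrand_integrable_inner])
      fix u assume u: "u \<in> {e..1 - e}"
      then have u': "0 < u" "u < 1" using elim by auto
      have "?g u \<le> 1 / (1 - u) * u powr \<alpha>"
      proof (cases "u \<le> 1 / 2")
        case True
        then have "1 / (1 - u) - 2 \<le> 0" using u' by (simp add: field_simps)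
        then have "?g u \<le> 0" by (intro mult_nonneg_nonpos) auto
        also have "0 \<le> 1 / (1 - u) * u powr \<alpha>" using u' by simp
        finally show ?thesis .
      next
        case False
        then have "(1 / 2) powr \<alpha> \<le> u powr \<alpha>" using assms by (intro powr_mono2) auto
        then have "(1 / 2) powr \<alpha> * (1 / (1 - u)) \<le> u powr \<alpha> * (1 / (1 - u))"
          using u' by (intro mult_right_mono) auto
        moreover have "?g u \<le> (1 / 2) powr \<alpha> * (1 / (1 - u))"
          by (intro mult_left_mono) auto
        ultimately show ?thesis by (simp add: mult.commute)
      qed
      also have "\<dots> = 1 / (1 - u) * 1 * u powr \<alpha>" by simp
      also have "\<dots> \<le> 1 / (1 - u) * (1 + \<mu> / \<nu> * u) ^ N * u powr \<alpha>"
        using u' assms by (intro mult_right_mono mult_left_mono one_le_power) auto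
      also have "1 / (1 - u) * (1 + \<mu> / \<nu> * u) ^ N * u powr \<alpha> =
          (1 - u) powi (int N - int N - 1) * (1 + \<mu> / \<nu> * u) ^ N * u powr \<alpha>"
        by (simp add: inverse_eq_divide)
      finally show "?g u \<le> (1 - u) powi (int N - int N - 1) * (1 + \<mu> / \<nu> * u) ^ N * u powr \<alpha>" .
    qed (use elim in auto)
    finally show ?case using assms unfolding engset_d_def by simp
  qed
qed

lemma engset_near_powr_integral:
  assumes "x \<le> N" "y \<le> N"
  obtains K where
    "\<And>A \<alpha> z. z \<in> {x, y} \<Longrightarrow> A \<in> sets borel \<Longrightarrow> A \<subseteq> {0..1} \<Longrightarrow> \<alpha> \<ge> 0 \<Longrightarrow>
      set_integrable lborel A (\<lambda>u. u powr (\<alpha> - 1)) \<Longrightarrow>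
      \<bar>engset_D A N \<nu> \<mu> z \<alpha> - (LBINT u:A. u powr (\<alpha> - 1))\<bar> \<le> K \<and>
      \<bar>engset_B A N \<nu> \<mu> z \<alpha> - (LBINT u:A. u powr (\<alpha> - 1))\<bar> \<le> K"
proof -
  \<comment> \<open>The parameters \<nu> and \<mu> are arguments so that \<open>P\<close> can also
    be used with the two exchanged, which gives the bounds for B.\<close>
  define P where "P \<nu> \<mu> z K \<longleftrightarrow> (\<forall>A \<alpha>. A \<in> sets borel \<longrightarrow> A \<subseteq> {0..1} \<longrightarrow> \<alpha> \<ge> 0 \<longrightarrow>
      set_integrable lborel A (\<lambda>u. u powr (\<alpha> - 1)) \<longrightarrow>
      \<bar>engset_D A N \<nu> \<mu> z \<alpha> - (LBINT u:A. u powr (\<alpha> - 1))\<bar> \<le> K)" for \<nu> \<mu> z K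
  have ex: "\<exists>K\<ge>0. P \<nu> \<mu> z K" for \<nu> \<mu> z
    unfolding P_def using engset_D_near_powr_integral[of N \<nu> \<mu> z] by metis
  have mono: "P \<nu> \<mu> z K'" if "P \<nu> \<mu> z K" "K \<le> K'" for \<nu> \<mu> z K K'
    using that unfolding P_def by (meson order_trans)
  obtain K1 K2 K3 K4 where K: "K1 \<ge> 0" "K2 \<ge> 0" "K3 \<ge> 0" "K4 \<ge> 0"
    "P \<nu> \<mu> x K1" "P \<nu> \<mu> y K2" "P \<mu> \<nu> (N - x) K3" "P \<mu> \<nu> (N - y) K4"
    using ex by metis
  define K where "K = K1 + K2 + K3 + K4"
  have "P \<nu> \<mu> z K" "P \<mu> \<nu> (N - z) K" if "z \<in> {x, y}" for z
    using that K by (auto simp: K_def intro: mono)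
  then show ?thesis
    using assms by (intro that[of K]) (auto simp: P_def engset_B_eq_D)
qed

lemma weighted_deviation_le:
  fixes B D L K b d :: real
  assumes "0 \<le> d" "0 \<le> b" "\<bar>B - L\<bar> \<le> K" "\<bar>D - L\<bar> \<le> K"
  shows "\<bar>d * B + b * D - (d + b) * L\<bar> \<le> (d + b) * K"
proof -
  have "d * B + b * D - (d + b) * L = d * (B - L) + b * (D - L)" by (simp add: algebra_simps)
  also have "\<bar>\<dots>\<bar> \<le> d * \<bar>B - L\<bar> + b * \<bar>D - L\<bar>"
    using assms by (intro order_trans[OF abs_triangle_ineq]) (simp add: abs_mult)
  also have "\<dots> \<le> d * K + b * K" using assms by (intro add_mono mult_left_mono)
  finally show ?thesis by (simp add: algebra_simps)
qed

text \<open>For \<alpha> > 0 the only divergent integral is d with C = N, hence the extra condition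
  in the second conjunct. The limits over \<open>{e..1 - e}\<close> also give the quotients a
  meaning at \<alpha> = 0 and at C = N.\<close>

theorem proposition5:
  fixes \<mu> \<nu> \<alpha> :: real and N C x y :: nat
    and M :: "nat \<Rightarrow> 'w measure" and X :: "real \<Rightarrow> 'w \<Rightarrow> nat"
  assumes "\<mu> > 0" and "\<nu> > 0" and "\<mu> + \<nu> = 1"
    and "1 \<le> C" and "C \<le> N"
    and "\<And>z. z \<le> C \<Longrightarrow> engset_process (M z) N C \<nu> \<mu> z X"
    and "x \<le> y" and "y \<le> C" and "\<alpha> \<ge> 0"
  shows "(\<alpha> > 0 \<longrightarrow>
            hitting_laplace (M x) X y \<alpha> = up_quotient {0..1} N \<nu> \<mu> x y \<alpha>) \<and>
         (\<alpha> > 0 \<and> C < N \<longrightarrow>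
            hitting_laplace (M y) X x \<alpha> = down_quotient {0..1} N C \<nu> \<mu> x y \<alpha>) \<and>
         ((\<lambda>e. up_quotient {e..1 - e} N \<nu> \<mu> x y \<alpha>)
            \<longlongrightarrow> hitting_laplace (M x) X y \<alpha>) (at_right 0) \<and>
         ((\<lambda>e. down_quotient {e..1 - e} N C \<nu> \<mu> x y \<alpha>)
            \<longlongrightarrow> hitting_laplace (M y) X x \<alpha>) (at_right 0)"
proof -
  note \<mu> = assms(1) and \<nu> = assms(2) and \<mu>\<nu> = assms(3) and xy = assms(7) and yC = assms(8)
  have CN: "C \<le> N" and xC: "x \<le> C" and xN: "x \<le> N" and yN: "y \<le> N"
    using assms(5,7,8) by auto
  define B where "B a z = engset_B {0..1} N \<nu> \<mu> z a" for a z
  define D where "D a z = engset_D {0..1} N \<nu> \<mu> z a" for a z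
  define b where "b a = engset_b {0..1} N C \<nu> \<mu> a" for a
  define d where "d a = engset_d {0..1} N C \<nu> \<mu> a" for a
  \<comment> \<open>For C = N the library value of the divergent \<open>d a\<close> is 0, and the
    combination would collapse to a multiple of D; hence the separate branch.\<close>
  define h where "h a z = (if C < N then d a * B a z + b a * D a z else B a z)" for a z
  have Dpos: "D a z > 0" if "a > 0" for a z
    unfolding D_def using \<mu> \<nu> that
    by (intro engset_D_pos[where a=0 and b=1] LBINT_powr_0_1) auto
  have Bpos: "B a z > 0" if "a > 0" "z \<le> N" for a z
    unfolding B_def engset_B_eq_D[OF that(2)] using \<mu> \<nu> that
    by (intro engset_D_pos[where a=0 and b=1] LBINT_powr_0_1) auto
  have dpos: "d a > 0" if "a \<ge> 0" "C < N" for a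
    unfolding d_def using \<mu> \<nu> that by (intro engset_d_pos engset_d_integrand_integrable) auto
  have bpos: "b a > 0" if "a \<ge> 0" "C < N" for a
    unfolding b_def engset_b_eq_d[OF that(2)]
    using \<mu> \<nu> that by (intro engset_d_pos engset_d_integrand_integrable) auto
  have hpos: "h a z > 0" if "a > 0" "z \<le> N" for a z
    unfolding h_def using Dpos Bpos dpos bpos that by (auto intro!: add_pos_pos mult_pos_pos)
  have D_harm: "\<mu> * real s * (D a (s - 1) - D a s) + \<nu> * (real N - real s) * (D a (Suc s) - D a s) = a * D a s"
    if "a > 0" "s < N" for a s
    unfolding D_def using \<mu> \<nu> \<mu>\<nu> that by (intro engset_D_harmonic)
  have h_harm: "\<mu> * real s * (h a (s - 1) - h a s) +
      (if s < C then \<nu> * (real N - real s) * (h a (Suc s) - h a s) else 0) = a * h a s"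
    if "a > 0" "0 < s" "s \<le> C" for a s
  proof (cases "C < N")
    case True
    then have h: "h a = (\<lambda>z. engset_d {0..1} N C \<nu> \<mu> a * engset_B {0..1} N \<nu> \<mu> z a +
        engset_b {0..1} N C \<nu> \<mu> a * engset_D {0..1} N \<nu> \<mu> z a)"
      by (intro ext) (simp add: h_def d_def b_def B_def D_def)
    show ?thesis
      unfolding h by (rule engset_down_harmonic[OF \<nu> \<mu> \<mu>\<nu> True that(2,3,1)])
  next
    case False
    \<comment> \<open>At s = C = N the coefficient N - s is 0, so B satisfies the capped equation as
      it stands.\<close>
    then have "C = N" using CN by simp
    then show ?thesis
      using engset_B_harmonic[of \<nu> \<mu> s N a] \<mu> \<nu> \<mu>\<nu> that
      by (cases "s = N") (auto simp: h_def B_def)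
  qed
  have laplace: "hitting_laplace (M z) X t a = (if z \<le> t then D a z / D a t else h a z / h a t)"
    if "a > 0" "z \<le> C" "t \<le> C" for a z t
  proof (rule engset_hitting_laplace[OF assms(6)[OF that(2)] that(3,2,1)])
    show "D a t \<noteq> 0" "h a t \<noteq> 0"
      using Dpos[of a t] hpos[of a t] that CN by auto
  qed (use that CN D_harm h_harm in auto)
  have up: "hitting_laplace (M x) X y a = D a x / D a y" if "a > 0" for a
    using laplace[OF that xC yC] xy by simp
  \<comment> \<open>For \<open>x = y\<close> the conditional in \<open>laplace\<close> selects the
    quotient of D; it equals 1, as does the quotient of \<open>h\<close>.\<close>
  have down: "hitting_laplace (M y) X x a = h a y / h a x" if "a > 0" for a
    using laplace[OF that yC xC] xy Dpos[OF that, of x] hpos[OF that xN] by auto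
  obtain K where K: "\<And>A \<alpha> z. z \<in> {x, y} \<Longrightarrow> A \<in> sets borel \<Longrightarrow> A \<subseteq> {0..1} \<Longrightarrow> \<alpha> \<ge> 0 \<Longrightarrow>
      set_integrable lborel A (\<lambda>u. u powr (\<alpha> - 1)) \<Longrightarrow>
      \<bar>engset_D A N \<nu> \<mu> z \<alpha> - (LBINT u:A. u powr (\<alpha> - 1))\<bar> \<le> K \<and>
      \<bar>engset_B A N \<nu> \<mu> z \<alpha> - (LBINT u:A. u powr (\<alpha> - 1))\<bar> \<le> K"
    using engset_near_powr_integral[OF xN yN] by metis
  have zero: "hitting_laplace (M x) X y 0 = 1" "hitting_laplace (M y) X x 0 = 1"
  proof -
    \<comment> \<open>Along these \<alpha> the common divergent part 1 / \<alpha> is exactly n +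
      1.\<close>
    define a where "a n = 1 / real (Suc n)" for n
    have a: "a n > 0" for n by (simp add: a_def)
    define L where "L n = (LBINT u:{0..1}. u powr (a n - 1))" for n
    have L: "L n = real (Suc n)" for n
      unfolding L_def using a[of n] by (subst LBINT_powr_0_1(2)) (auto simp: a_def)
    have L_top: "filterlim L at_top sequentially" unfolding L by real_asymp
    have near: "\<bar>D (a n) z - L n\<bar> \<le> K" "\<bar>B (a n) z - L n\<bar> \<le> K" if "z \<in> {x, y}" for n z
      using K[OF that, of "{0..1}" "a n"] a[of n] LBINT_powr_0_1(1)[of "a n - 1"]
      by (simp_all add: D_def B_def L_def)
    have "(\<lambda>n. D (a n) x / D (a n) y) \<longlonglongrightarrow> 1"
      by (rule quotient_tendsto_1[OF L_top, where w="\<lambda>_. 1" and K=K]) (simp add: near)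
    then have "(\<lambda>n. hitting_laplace (M x) X y (a n)) \<longlonglongrightarrow> 1" by (simp add: up a)
    then show "hitting_laplace (M x) X y 0 = 1"
      using hitting_laplace_tendsto_zero[OF assms(6)[OF xC, unfolded engset_process_def], of y] LIMSEQ_unique
      unfolding a_def by blast
    have "(\<lambda>n. h (a n) y / h (a n) x) \<longlonglongrightarrow> 1"
    proof (rule quotient_tendsto_1[OF L_top, where w="\<lambda>n. if C < N then d (a n) + b (a n) else 1" and K=K],
        intro always_eventually allI)
      fix n
      show "0 < (if C < N then d (a n) + b (a n) else 1) \<and>
          \<bar>h (a n) y - (if C < N then d (a n) + b (a n) else 1) * L n\<bar> \<le> (if C < N then d (a n) + b (a n) else 1) * K \<and>
          \<bar>h (a n) x - (if C < N then d (a n) + b (a n) else 1) * L n\<bar> \<le> (if C < N then d (a n) + b (a n) else 1) * K"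
      proof (cases "C < N")
        case True
        then have "0 < d (a n)" "0 < b (a n)" using dpos bpos a[of n] by (simp_all add: less_imp_le)
        with True show ?thesis
          by (auto simp: h_def near intro!: weighted_deviation_le add_pos_pos)
      qed (simp add: h_def near)
    qed
    then have "(\<lambda>n. hitting_laplace (M y) X x (a n)) \<longlonglongrightarrow> 1" by (simp add: down a)
    then show "hitting_laplace (M y) X x 0 = 1"
      using hitting_laplace_tendsto_zero[OF assms(6)[OF yC, unfolded engset_process_def], of x] LIMSEQ_unique
      unfolding a_def by blast
  qed
  \<comment> \<open>Below 1/2 the interval \<open>{e..1 - e}\<close> is nondegenerate, which the
    positivity of b and d requires.\<close>
  have small: "\<forall>\<^sub>F e in at_right (0::real). e \<in> {0<..<1 / 2}"
    by (rule eventually_at_right_real) simp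
  have near: "\<forall>\<^sub>F e in at_right (0::real). \<forall>z\<in>{x, y}.
      \<bar>engset_D {e..1 - e} N \<nu> \<mu> z 0 - (LBINT u:{e..1 - e}. u powr (0 - 1))\<bar> \<le> K \<and>
      \<bar>engset_B {e..1 - e} N \<nu> \<mu> z 0 - (LBINT u:{e..1 - e}. u powr (0 - 1))\<bar> \<le> K"
    using small
  proof eventually_elim
    case (elim e)
    then show ?case using powr_integrable_inner[of e "0 - 1"] by (intro ballI K) auto
  qed
  have D_lim: "((\<lambda>e. engset_D {e..1 - e} N \<nu> \<mu> z \<alpha>) \<longlongrightarrow> D \<alpha> z) (at_right 0)" if "\<alpha> > 0" for z
    unfolding D_def using that by (rule engset_D_tendsto)
  have B_lim: "((\<lambda>e. engset_B {e..1 - e} N \<nu> \<mu> z \<alpha>) \<longlongrightarrow> B \<alpha> z) (at_right 0)" if "\<alpha> > 0" "z \<le> N" for z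
    unfolding B_def engset_B_eq_D[OF that(2)] using that(1) by (rule engset_D_tendsto)
  have pos_inner: "\<forall>\<^sub>F e in at_right 0. 0 < engset_d {e..1 - e} N C \<nu> \<mu> \<alpha> \<and> 0 < engset_b {e..1 - e} N C \<nu> \<mu> \<alpha>"
    using small
  proof eventually_elim
    case (elim e)
    then show ?case using \<mu> \<nu>
      by (auto intro!: engset_d_pos engset_b_pos engset_d_integrand_integrable_inner engset_b_integrand_integrable_inner)
  qed
  have "((\<lambda>e. up_quotient {e..1 - e} N \<nu> \<mu> x y \<alpha>) \<longlongrightarrow> hitting_laplace (M x) X y \<alpha>) (at_right 0)"
  proof (cases "\<alpha> = 0")
    case True
    have "((\<lambda>e. engset_D {e..1 - e} N \<nu> \<mu> x 0 / engset_D {e..1 - e} N \<nu> \<mu> y 0) \<longlongrightarrow> 1) (at_right 0)"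
      by (rule quotient_tendsto_1[OF LBINT_inverse_at_top, where w="\<lambda>_. 1" and K=K])
        (use near in \<open>auto elim!: eventually_mono\<close>)
    then show ?thesis unfolding up_quotient_def True zero .
  next
    case False
    then have "\<alpha> > 0" using assms(9) by simp
    then show ?thesis
      unfolding up_quotient_def up[OF \<open>\<alpha> > 0\<close>]
      using Dpos[of \<alpha> y] by (intro tendsto_divide D_lim) auto
  qed
  moreover have "((\<lambda>e. down_quotient {e..1 - e} N C \<nu> \<mu> x y \<alpha>) \<longlongrightarrow> hitting_laplace (M y) X x \<alpha>) (at_right 0)"
  proof (cases "\<alpha> = 0")
    case True
    let ?d = "\<lambda>e. engset_d {e..1 - e} N C \<nu> \<mu> 0" and ?b = "\<lambda>e. engset_b {e..1 - e} N C \<nu> \<mu> 0"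
    have "((\<lambda>e. (?d e * engset_B {e..1 - e} N \<nu> \<mu> y 0 + ?b e * engset_D {e..1 - e} N \<nu> \<mu> y 0) /
        (?d e * engset_B {e..1 - e} N \<nu> \<mu> x 0 + ?b e * engset_D {e..1 - e} N \<nu> \<mu> x 0)) \<longlongrightarrow> 1) (at_right 0)"
      by (rule quotient_tendsto_1[OF LBINT_inverse_at_top, where w="\<lambda>e. ?d e + ?b e" and K=K],
          use near pos_inner[unfolded True] in eventually_elim)
        (auto intro!: weighted_deviation_le add_pos_pos)
    then show ?thesis unfolding down_quotient_def True zero .
  next
    case False
    then have \<alpha>: "\<alpha> > 0" using assms(9) by simp
    let ?d = "\<lambda>e. engset_d {e..1 - e} N C \<nu> \<mu> \<alpha>" and ?b = "\<lambda>e. engset_b {e..1 - e} N C \<nu> \<mu> \<alpha>"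
    show ?thesis
    proof (cases "C < N")
      case True
      have "(?d \<longlongrightarrow> d \<alpha>) (at_right 0)"
        unfolding d_def using True assms(9) by (rule engset_d_tendsto)
      moreover have "(?b \<longlongrightarrow> b \<alpha>) (at_right 0)"
        unfolding b_def engset_b_eq_d[OF True] using True assms(9) by (intro engset_d_tendsto) auto
      ultimately show ?thesis
        unfolding down_quotient_def down[OF \<alpha>] using True hpos[OF \<alpha> xN]
        by (auto simp: h_def intro!: tendsto_intros D_lim B_lim \<alpha> xN yN)
    next
      case False
      then have C: "C = N" using CN by simp
      have d_top: "filterlim ?d at_top (at_right 0)"
        unfolding C using \<mu> \<nu> assms(9) by (rule engset_d_full_at_top)
      have "((\<lambda>e. \<nu> / ?d e) \<longlongrightarrow> 0) (at_right 0)"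
        by (rule tendsto_divide_0[OF tendsto_const filterlim_at_top_imp_at_infinity[OF d_top]])
      then have ratio: "((\<lambda>e. ?b e / ?d e) \<longlongrightarrow> 0) (at_right 0)"
      proof (rule Lim_null_comparison[rotated])
        show "\<forall>\<^sub>F e in at_right 0. norm (?b e / ?d e) \<le> \<nu> / ?d e"
          using small pos_inner
        proof eventually_elim
          case (elim e)
          then have "?b e \<le> \<nu>" unfolding C using \<mu> \<nu> assms(9) by (intro engset_b_le) auto
          then show ?case using elim by (auto intro!: divide_right_mono)
        qed
      qed
      \<comment> \<open>Numerator and denominator are divided by d, so that d tending to infinity
        becomes b / d tending to 0 and only B survives.\<close>
      have "((\<lambda>e. (engset_B {e..1 - e} N \<nu> \<mu> y \<alpha> + ?b e / ?d e * engset_D {e..1 - e} N \<nu> \<mu> y \<alpha>) /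
          (engset_B {e..1 - e} N \<nu> \<mu> x \<alpha> + ?b e / ?d e * engset_D {e..1 - e} N \<nu> \<mu> x \<alpha>)) \<longlongrightarrow>
          (B \<alpha> y + 0 * D \<alpha> y) / (B \<alpha> x + 0 * D \<alpha> x)) (at_right 0)"
        using Bpos[OF \<alpha> xN]
        by (intro tendsto_intros ratio D_lim B_lim \<alpha> xN yN) auto
      then have "((\<lambda>e. (engset_B {e..1 - e} N \<nu> \<mu> y \<alpha> + ?b e / ?d e * engset_D {e..1 - e} N \<nu> \<mu> y \<alpha>) /
          (engset_B {e..1 - e} N \<nu> \<mu> x \<alpha> + ?b e / ?d e * engset_D {e..1 - e} N \<nu> \<mu> x \<alpha>)) \<longlongrightarrow>
          hitting_laplace (M y) X x \<alpha>) (at_right 0)"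
        unfolding down[OF \<alpha>] using False by (simp add: h_def)
      then show ?thesis
      proof (rule Lim_transform_eventually)
        have factor: "(v + q / p * w) / (v' + q / p * w') = (p * v + q * w) / (p * v' + q * w')"
          if "p > 0" for p q v w v' w' :: real
        proof -
          have "p * v + q * w = p * (v + q / p * w)" "p * v' + q * w' = p * (v' + q / p * w')"
            using that by (simp_all add: distrib_left)
          then show ?thesis using that by simp
        qed
        show "\<forall>\<^sub>F e in at_right 0. (engset_B {e..1 - e} N \<nu> \<mu> y \<alpha> + ?b e / ?d e * engset_D {e..1 - e} N \<nu> \<mu> y \<alpha>) /
          (engset_B {e..1 - e} N \<nu> \<mu> x \<alpha> + ?b e / ?d e * engset_D {e..1 - e} N \<nu> \<mu> x \<alpha>) =
          down_quotient {e..1 - e} N C \<nu> \<mu> x y \<alpha>"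
          using pos_inner by eventually_elim (simp only: down_quotient_def factor)
      qed
    qed
  qed
  moreover have "hitting_laplace (M x) X y \<alpha> = up_quotient {0..1} N \<nu> \<mu> x y \<alpha>" if "\<alpha> > 0"
    using up[OF that] by (simp add: up_quotient_def D_def)
  moreover have "hitting_laplace (M y) X x \<alpha> = down_quotient {0..1} N C \<nu> \<mu> x y \<alpha>" if "\<alpha> > 0" "C < N"
    using down[OF that(1)] that(2) by (simp add: down_quotient_def h_def d_def b_def B_def D_def)
  ultimately show ?thesis by blast
qed

end
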